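(* Let $(\Omega,\mathfrak{F},(\mathfrak{F}_n)_{n\in\mathbb{N}})$ be a filtered measurable space with $\mathbb{N}=\{1,2,\dots\}$, $\mathfrak{F}_1=\{\emptyset,\Omega\}$ and $\mathfrak{F}=\sigma\bigl(\bigcup_{n\in\mathbb{N}}\mathfrak{F}_n\bigr)$. Let $\mathbb{P},\mathbb{P}'$ be probability measures on $(\Omega,\mathfrak{F})$ such that $\mathbb{P}|_{\mathfrak{F}_n}\sim\mathbb{P}'|_{\mathfrak{F}_n}$ for all $n\in\mathbb{N}$. For $n\in\mathbb{N}$ let $\Phi_n=\frac{d\mathbb{P}'|_{\mathfrak{F}_n}}{d\mathbb{P}|_{\mathfrak{F}_n}}$ and $\varphi_n=\frac{\Phi_{n+1}}{\Phi_n}$. Then the iterated limit $$M=\lim_{n\to\infty}\lim_{k\to\infty}\mathbb{E}\Bigl(\prod_{i=n}^{k}\sqrt{\varphi_i}\,\Big|\,\mathfrak{F}_n\Bigr)$$ exists $(\mathbb{P}+\mathbb{P}')$-almost everywhere, and $\mathbb{P}\sim\mathbb{P}'$ if and only if $M=1$ $(\mathbb{P}+\mathbb{P}')$-almost everywhere. In this case, $\Phi_n^{1/2}\to\bigl(\frac{d\mathbb{P}'}{d\mathbb{P}}\bigr)^{1/2}$ in $L^2(\mathbb{P})$ as $n\to\infty$.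
   Context: $\sim$ denotes mutual absolute continuity of measures. $\mathbb{E}$ denotes expectation with respect to $\mathbb{P}$. $\Phi_n$ is the $\mathfrak{F}_n$-measurable Radon-Nikodym derivative, chosen with values in $(0,\infty)$. The conditional expectations given $\mathfrak{F}_n$ are $\mathfrak{F}_n$-measurable and hence defined up to $(\mathbb{P}+\mathbb{P}')$-null sets, because $\mathbb{P}|_{\mathfrak{F}_n}\sim\mathbb{P}'|_{\mathfrak{F}_n}$. *)

theory Defs
  imports "HOL-Probability.Probability"
begin

definition sum_measure :: "'a measure \<Rightarrow> 'a measure \<Rightarrow> 'a measure" where
  "sum_measure M N = measure_of (space M) (sets M) (\<lambda>A. emeasure M A + emeasure N A)"

lemma space_sum_measure [simp]: "space (sum_measure M N) = space M"
  by (simp add: sum_measure_def)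

lemma sets_sum_measure [simp, measurable_cong]: "sets (sum_measure M N) = sets M"
  by (simp add: sum_measure_def)

lemma emeasure_sum_measure:
  assumes [simp]: "sets N = sets M" and A: "A \<in> sets M"
  shows "emeasure (sum_measure M N) A = emeasure M A + emeasure N A"
proof (rule emeasure_measure_of [OF sum_measure_def])
  show "sets M \<subseteq> Pow (space M)"
    by (rule sets.space_closed)
  show "A \<in> sets (sum_measure M N)"
    using A by simp
  show "positive (sets (sum_measure M N)) (\<lambda>A. emeasure M A + emeasure N A)"
    by (simp add: positive_def)
  show "countably_additive (sets (sum_measure M N)) (\<lambda>A. emeasure M A + emeasure N A)"
  proof (rule countably_additiveI)
    fix B :: "nat \<Rightarrow> 'a set"
    assume B: "range B \<subseteq> sets (sum_measure M N)" and d: "disjoint_family B"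
    have "range B \<subseteq> sets M" "range B \<subseteq> sets N"
      using B by simp_all
    then show "(\<Sum>i. emeasure M (B i) + emeasure N (B i)) =
        emeasure M (\<Union>i. B i) + emeasure N (\<Union>i. B i)"
      using d by (simp add: suminf_add [symmetric] suminf_emeasure)
  qed
qed

definition mutually_absolutely_continuous :: "'a measure \<Rightarrow> 'a measure \<Rightarrow> bool" where
  "mutually_absolutely_continuous M N \<longleftrightarrow>
    absolutely_continuous M N \<and> absolutely_continuous N M"

text \<open>
  The \<open>G\<close>-measurable versions with values in \<open>(0,\<infinity>)\<close> of the Radon-Nikodym derivative of the
  restriction of \<open>Q\<close> to \<open>G\<close> with respect to the restriction of \<open>P\<close> to \<open>G\<close>.
\<close>
definition positive_restr_RN_version ::
    "'a measure \<Rightarrow> 'a measure \<Rightarrow> 'a measure \<Rightarrow> ('a \<Rightarrow> real) \<Rightarrow> bool" where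
  "positive_restr_RN_version P Q G f \<longleftrightarrow>
    f \<in> borel_measurable G \<and> (\<forall>x\<in>space G. 0 < f x) \<and>
    (AE x in restr_to_subalg P G.
      ennreal (f x) = RN_deriv (restr_to_subalg P G) (restr_to_subalg Q G) x)"

definition square_integrable :: "'a measure \<Rightarrow> ('a \<Rightarrow> real) \<Rightarrow> bool" where
  "square_integrable M f \<longleftrightarrow> f \<in> borel_measurable M \<and> integrable M (\<lambda>x. (f x)\<^sup>2)"

text \<open>Sequences are indexed by \<open>{1, 2, \<dots>}\<close>; the value at index \<open>0\<close> is irrelevant.\<close>
definition tendsto_in_L2 :: "'a measure \<Rightarrow> (nat \<Rightarrow> 'a \<Rightarrow> real) \<Rightarrow> ('a \<Rightarrow> real) \<Rightarrow> bool" where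
  "tendsto_in_L2 M f g \<longleftrightarrow>
    (\<forall>n\<ge>1. square_integrable M (f n)) \<and> square_integrable M g \<and>
    (\<lambda>n. sqrt (\<integral>x. (f n x - g x)\<^sup>2 \<partial>M)) \<longlonglongrightarrow> 0"

definition density_ratio :: "(nat \<Rightarrow> 'a \<Rightarrow> real) \<Rightarrow> nat \<Rightarrow> 'a \<Rightarrow> real" where
  "density_ratio \<Phi> n x = \<Phi> (n + 1) x / \<Phi> n x"

definition cond_sqrt_prod ::
    "'a measure \<Rightarrow> (nat \<Rightarrow> 'a measure) \<Rightarrow> (nat \<Rightarrow> 'a \<Rightarrow> real) \<Rightarrow> nat \<Rightarrow> nat \<Rightarrow> 'a \<Rightarrow> real" where
  "cond_sqrt_prod P F \<Phi> n k =
    real_cond_exp P (F n) (\<lambda>x. \<Prod>i=n..k. sqrt (density_ratio \<Phi> i x))"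

end

theory Submission
  imports Defs
begin

text \<open>
  The idea is to treat \<open>P\<close> and \<open>P'\<close> symmetrically, by taking densities with respect to
  \<open>R = P + P'\<close> instead of working under \<open>P\<close>. Let \<open>a\<close> and \<open>b = 1 - a\<close> be the densities of \<open>P\<close> and
  \<open>P'\<close>, and let \<open>a\<^sub>n\<close>, \<open>b\<^sub>n\<close> be their conditional expectations under \<open>R\<close> given \<open>F n\<close>. Then
  \<open>\<Phi> n = b\<^sub>n / a\<^sub>n\<close>, and all the martingales of the problem are closed: they are conditional
  expectations of the bounded functions \<open>a\<close> and \<open>b\<close>. So Levy's upward theorem applies to them
  almost everywhere with respect to \<open>R\<close>, also on the part of the space on which \<open>P\<close> and \<open>P'\<close> are
  mutually singular.

  The product over \<open>n \<le> i \<le> k\<close> telescopes to \<open>sqrt (\<Phi> (k + 1) / \<Phi> n)\<close>. Bayes' formula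
  (\<open>Bayes\<close>, \<open>cond_exp_sqrt_ratio\<close>) turns its conditional expectation under \<open>P\<close> into the symmetric
  expression \<open>E\<^sub>R (sqrt (a\<^bsub>k+1\<^esub> * b\<^bsub>k+1\<^esub>) | F n) / sqrt (a\<^sub>n * b\<^sub>n)\<close>. Since \<open>a\<^sub>k\<close> tends to \<open>a\<close> and
  \<open>b\<^sub>k\<close> to \<open>b\<close>, conditional dominated convergence gives the inner limit
  \<open>E\<^sub>R (sqrt (a * b) | F n) / sqrt (a\<^sub>n * b\<^sub>n)\<close>.

  For the outer limit (\<open>hellinger_quotient_tendsto\<close>), where \<open>a * b > 0\<close> numerator and denominator
  have the same positive limit, so the quotient tends to \<open>1\<close>. Where \<open>a * b = 0\<close> both tend to \<open>0\<close>;
  there the conditional Cauchy-Schwarz inequality, applied to \<open>a\<close> and \<open>b\<close> restricted to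
  \<open>{a * b > 0}\<close>, shows that the quotient tends to \<open>0\<close>. Hence \<open>M\<close> is the indicator of
  \<open>{a * b > 0}\<close>, and \<open>P\<close> and \<open>P'\<close> are equivalent exactly if this set has full measure.

  In that case \<open>\<Phi> n\<close> is the conditional expectation under \<open>P\<close> of the density of \<open>P'\<close>, so it
  converges in \<open>L\<^sup>1\<close>, and \<open>(sqrt x - sqrt y)\<^sup>2 \<le> \<bar>x - y\<bar>\<close> turns this into convergence in \<open>L\<^sup>2\<close> of the
  square roots.
\<close>

section \<open>Conditional expectations\<close>

lemma (in sigma_finite_subalgebra) real_cond_exp_abs_le:
  assumes "integrable M f"
  shows "AE x in M. \<bar>real_cond_exp M F f x\<bar> \<le> real_cond_exp M F (\<lambda>x. \<bar>f x\<bar>) x"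
proof -
  have "AE x in M. real_cond_exp M F f x \<le> real_cond_exp M F (\<lambda>x. \<bar>f x\<bar>) x"
    using assms by (intro real_cond_exp_mono) auto
  moreover have "AE x in M. real_cond_exp M F (\<lambda>x. (-1) * f x) x \<le> real_cond_exp M F (\<lambda>x. \<bar>f x\<bar>) x"
    using assms by (intro real_cond_exp_mono) auto
  moreover have "AE x in M. real_cond_exp M F (\<lambda>x. (-1) * f x) x = (-1) * real_cond_exp M F f x"
    by (rule real_cond_exp_cmult[OF assms])
  ultimately show ?thesis
    by eventually_elim auto
qed

lemma (in sigma_finite_subalgebra) integral_abs_real_cond_exp_le:
  assumes "integrable M f"
  shows "(\<integral>x. \<bar>real_cond_exp M F f x\<bar> \<partial>M) \<le> (\<integral>x. \<bar>f x\<bar> \<partial>M)"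
proof -
  have "(\<integral>x. \<bar>real_cond_exp M F f x\<bar> \<partial>M) \<le> (\<integral>x. real_cond_exp M F (\<lambda>x. \<bar>f x\<bar>) x \<partial>M)"
    using assms by (intro integral_mono_AE real_cond_exp_abs_le integrable_abs real_cond_exp_int)
  also have "\<dots> = (\<integral>x. \<bar>f x\<bar> \<partial>M)"
    using assms by (intro real_cond_exp_int) simp
  finally show ?thesis .
qed

text \<open>
  The errors \<open>\<bar>f n - g\<bar>\<close> with \<open>n \<ge> k\<close> are dominated by their supremum \<open>h k\<close>, which decreases to \<open>0\<close>
  and is integrable. The conditional expectations of the \<open>h k\<close> have integrals tending to \<open>0\<close>, so
  their infimum vanishes almost everywhere, and it controls all late errors at once. The supremum
  is formed in the extended nonnegative reals, where it always exists and is measurable.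
\<close>
lemma (in sigma_finite_subalgebra) real_cond_exp_dominated_convergence:
  fixes f :: "nat \<Rightarrow> 'a \<Rightarrow> real"
  assumes [measurable]: "\<And>k. f k \<in> borel_measurable M" "g \<in> borel_measurable M"
    and w: "integrable M w"
    and lim: "AE x in M. (\<lambda>k. f k x) \<longlonglongrightarrow> g x"
    and bound: "\<And>k. AE x in M. \<bar>f k x\<bar> \<le> w x"
  shows "AE x in M. (\<lambda>k. real_cond_exp M F (f k) x) \<longlonglongrightarrow> real_cond_exp M F g x"
proof -
  have [measurable]: "w \<in> borel_measurable M"
    using w by simp
  have bound_all: "AE x in M. \<forall>k. \<bar>f k x\<bar> \<le> w x"
    using bound by (simp add: AE_all_countable)
  have bound_g: "AE x in M. \<bar>g x\<bar> \<le> w x"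
    using lim bound_all
  proof eventually_elim
    case (elim x)
    then show ?case
      by (intro LIMSEQ_le_const2[OF tendsto_rabs[OF elim(1)]]) auto
  qed
  have int_f: "integrable M (f k)" for k
    using bound[of k] by (intro Bochner_Integration.integrable_bound[OF w]) auto
  have int_g: "integrable M g"
    using bound_g by (intro Bochner_Integration.integrable_bound[OF w]) auto
  define h where "h k x = (SUP j. ennreal \<bar>f (k + j) x - g x\<bar>)" for k x
  have h_meas [measurable]: "h k \<in> borel_measurable M" for k
    unfolding h_def by measurable
  define H where "H k = nn_cond_exp M F (h k)" for k
  have h_upper: "ennreal \<bar>f n x - g x\<bar> \<le> h k x" if "k \<le> n" for n k x
    unfolding h_def using that by (intro SUP_upper2[of "n - k"]) auto
  have "(\<lambda>k. \<integral>\<^sup>+x. h k x \<partial>M) \<longlonglongrightarrow> (\<integral>\<^sup>+x. 0 \<partial>M)"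
  proof (rule nn_integral_dominated_convergence[where w = "\<lambda>x. ennreal (2 * w x)"])
    show "AE x in M. h k x \<le> ennreal (2 * w x)" for k
      using bound_all bound_g
    proof eventually_elim
      case (elim x)
      have "\<bar>f n x - g x\<bar> \<le> 2 * w x" for n
        using elim(1)[rule_format, of n] elim(2) by linarith
      then show ?case
        unfolding h_def by (intro SUP_least ennreal_leI)
    qed
    show "(\<integral>\<^sup>+x. ennreal (2 * w x) \<partial>M) < \<infinity>"
      using w integrable_mult_right[OF w, of 2] bound_g
      by (subst nn_integral_eq_integral) auto
    show "AE x in M. (\<lambda>k. h k x) \<longlonglongrightarrow> 0"
      using lim
    proof eventually_elim
      case (elim x)
      show ?case
      proof (rule order_tendstoI)
        fix e :: ennreal assume e: "0 < e"
        obtain d where d: "0 < d" "ennreal d < e"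
        proof (cases e rule: ennreal_cases)
          case (real r)
          then show ?thesis using e that[of "r / 2"] by (auto simp: ennreal_less_iff)
        next
          case top
          then show ?thesis using that[of 1] by simp
        qed
        obtain N where N: "\<And>n. N \<le> n \<Longrightarrow> \<bar>f n x - g x\<bar> < d"
          using LIMSEQ_D[OF elim d(1)] by auto
        show "\<forall>\<^sub>F k in sequentially. h k x < e"
        proof (rule eventually_sequentiallyI)
          fix k assume "N \<le> k"
          then have "h k x \<le> ennreal d"
            unfolding h_def using N by (intro SUP_least ennreal_leI less_imp_le) auto
          then show "h k x < e" using d(2) by (rule le_less_trans)
        qed
      qed simp
    qed
  qed auto
  then have int_H: "(\<lambda>k. \<integral>\<^sup>+x. H k x \<partial>M) \<longlonglongrightarrow> 0"
    using nn_cond_exp_intg[of "\<lambda>x. 1"] by (simp add: H_def)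
  have "(\<integral>\<^sup>+x. (INF k. H k x) \<partial>M) \<le> 0"
    by (rule LIMSEQ_le_const[OF int_H])
       (auto intro!: exI[of _ 0] nn_integral_mono INF_lower)
  then have inf_H: "AE x in M. (INF k. H k x) = 0"
    by (subst (asm) le_zero_eq, subst (asm) nn_integral_0_iff_AE) (auto simp: H_def)
  have "AE x in M. \<bar>real_cond_exp M F (\<lambda>x. f n x - g x) x\<bar> \<le> H k x" if "k \<le> n" for n k
  proof -
    have "AE x in M. \<bar>real_cond_exp M F (\<lambda>x. f n x - g x) x\<bar>
        \<le> nn_cond_exp M F (\<lambda>x. ennreal \<bar>f n x - g x\<bar>) x"
      by (intro real_cond_exp_abs) auto
    moreover have "AE x in M. nn_cond_exp M F (\<lambda>x. ennreal \<bar>f n x - g x\<bar>) x \<le> H k x"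
      unfolding H_def using h_upper[OF that] by (intro nn_cond_exp_mono) auto
    ultimately show ?thesis
      by eventually_elim (rule order_trans)
  qed
  then have "AE x in M. \<forall>k n. k \<le> n \<longrightarrow> ennreal \<bar>real_cond_exp M F (\<lambda>x. f n x - g x) x\<bar> \<le> H k x"
    by (simp add: AE_all_countable)
  moreover have "AE x in M. \<forall>n. real_cond_exp M F (\<lambda>x. f n x - g x) x
      = real_cond_exp M F (f n) x - real_cond_exp M F g x"
    unfolding AE_all_countable using int_f int_g by (intro allI real_cond_exp_diff)
  ultimately show ?thesis
    using inf_H
  proof eventually_elim
    case (elim x)
    show ?case
    proof (rule LIMSEQ_I)
      fix e :: real assume "0 < e"
      then have "(INF k. H k x) < ennreal e"
        using elim(3) by simp
      then obtain k where k: "H k x < ennreal e"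
        by (auto simp: INF_less_iff)
      show "\<exists>no. \<forall>n\<ge>no. norm (real_cond_exp M F (f n) x - real_cond_exp M F g x) < e"
      proof (intro exI[of _ k] allI impI)
        fix n assume "k \<le> n"
        then have "ennreal \<bar>real_cond_exp M F (f n) x - real_cond_exp M F g x\<bar> < ennreal e"
          using elim(1,2) k le_less_trans by fastforce
        then show "norm (real_cond_exp M F (f n) x - real_cond_exp M F g x) < e"
          by (simp add: ennreal_less_iff)
      qed
    qed
  qed
qed

text \<open>
  Minimising the right-hand side over \<open>t\<close> gives \<open>s \<le> sqrt (u * v)\<close>. Only rational \<open>t\<close> occur in the
  hypothesis because it will hold almost everywhere simultaneously for countably many \<open>t\<close>.
\<close>
lemma square_le_mult_if_weighted_am_gm:
  fixes s u v :: real
  assumes "0 \<le> s" "0 \<le> u" "0 \<le> v"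
    and am_gm: "\<And>t. t \<in> \<rat> \<Longrightarrow> 0 < t \<Longrightarrow> 2 * s \<le> t * u + v / t"
  shows "s\<^sup>2 \<le> u * v"
proof -
  have real_t: "2 * s \<le> t * u + v / t" if t: "0 < t" for t :: real
  proof -
    have "\<exists>q. (\<forall>n. q n \<in> \<rat> \<and> t < q n) \<and> q \<longlonglongrightarrow> t"
    proof -
      have "\<exists>q\<in>\<rat>. t < q \<and> q < t + inverse (real (Suc n))" for n
        using Rats_dense_in_real[of t "t + inverse (real (Suc n))"] by auto
      then obtain q where q: "\<And>n. q n \<in> \<rat>" "\<And>n. t < q n" "\<And>n. q n < t + inverse (real (Suc n))"
        by metis
      have "q \<longlonglongrightarrow> t"
        using q LIMSEQ_inverse_real_of_nat_add[of t]
        by (intro tendsto_sandwich[OF _ _ tendsto_const, of t q sequentially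
              "\<lambda>n. t + inverse (real (Suc n))"]) (auto intro!: always_eventually less_imp_le)
      with q show ?thesis
        by blast
    qed
    then obtain q where q: "\<And>n. q n \<in> \<rat>" "\<And>n. t < q n" "q \<longlonglongrightarrow> t"
      by blast
    have "(\<lambda>n. q n * u + v / q n) \<longlonglongrightarrow> t * u + v / t"
      using t by (intro tendsto_intros q) auto
    then show ?thesis
      by (rule LIMSEQ_le_const) (use q t am_gm less_trans in blast)
  qed
  show ?thesis
  proof (cases "u = 0 \<or> v = 0")
    case True
    have "s = 0"
    proof (rule ccontr)
      assume "s \<noteq> 0"
      then have "0 < s" using assms by simp
      have half: "s * (w / (w + 1)) \<le> s * 1" if "0 \<le> w" for w
        using \<open>0 < s\<close> that by (intro mult_left_mono) auto
      from True show False
      proof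
        assume "u = 0"
        then have "2 * s \<le> s * (v / (v + 1))"
          using real_t[of "(v + 1) / s"] \<open>0 < s\<close> \<open>0 \<le> v\<close> by (simp add: mult.commute)
        then show False using half[OF \<open>0 \<le> v\<close>] \<open>0 < s\<close> by linarith
      next
        assume "v = 0"
        then have "2 * s \<le> s * (u / (u + 1))"
          using real_t[of "s / (u + 1)"] \<open>0 < s\<close> \<open>0 \<le> u\<close> by simp
        then show False using half[OF \<open>0 \<le> u\<close>] \<open>0 < s\<close> by linarith
      qed
    qed
    then show ?thesis using assms by simp
  next
    case False
    then have uv: "0 < u" "0 < v" using assms by auto
    have "2 * s \<le> sqrt (v / u) * u + v / sqrt (v / u)"
      using uv by (intro real_t) auto
    also have "\<dots> = 2 * sqrt (u * v)"
      using uv by (simp add: real_sqrt_divide real_sqrt_mult field_simps flip: power2_eq_square)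
    finally have "s \<le> sqrt (u * v)" by simp
    then have "s\<^sup>2 \<le> (sqrt (u * v))\<^sup>2"
      using assms by (intro power_mono)
    then show ?thesis using assms by simp
  qed
qed

lemma weighted_am_gm_sqrt:
  fixes u v t :: real
  assumes "0 \<le> u" "0 \<le> v" "0 < t"
  shows "2 * sqrt (u * v) \<le> t * u + v / t"
  using arith_geo_mean_sqrt[of "t * u" "v / t"] assms by simp

lemma integrable_sqrt_mult:
  fixes u v :: "'a \<Rightarrow> real"
  assumes "integrable M u" "integrable M v" "AE x in M. 0 \<le> u x" "AE x in M. 0 \<le> v x"
  shows "integrable M (\<lambda>x. sqrt (u x * v x))"
proof (rule Bochner_Integration.integrable_bound)
  show "integrable M (\<lambda>x. u x + v x)" using assms by auto
  show "(\<lambda>x. sqrt (u x * v x)) \<in> borel_measurable M"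
    using assms by auto
  show "AE x in M. norm (sqrt (u x * v x)) \<le> norm (u x + v x)"
    using assms(3,4)
  proof eventually_elim
    case (elim x)
    then show ?case
      using weighted_am_gm_sqrt[of "u x" "v x" 1] by simp
  qed
qed

text \<open>
  The weighted inequality \<open>2 * sqrt (u * v) \<le> t * u + v / t\<close> is linear in \<open>u\<close> and \<open>v\<close>, so it survives
  conditioning for each fixed \<open>t\<close>; afterwards \<open>t\<close> can be optimised at each point separately.
\<close>
lemma (in sigma_finite_subalgebra) real_cond_exp_Cauchy_Schwarz:
  assumes int: "integrable M u" "integrable M v"
    and nonneg: "AE x in M. 0 \<le> u x" "AE x in M. 0 \<le> v x"
  shows "AE x in M. (real_cond_exp M F (\<lambda>x. sqrt (u x * v x)) x)\<^sup>2
      \<le> real_cond_exp M F u x * real_cond_exp M F v x"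
proof -
  let ?s = "\<lambda>x. sqrt (u x * v x)"
  have int_s: "integrable M ?s"
    using assms by (rule integrable_sqrt_mult)
  have "AE x in M. 2 * real_cond_exp M F ?s x \<le> t * real_cond_exp M F u x + real_cond_exp M F v x / t"
    if "0 < t" for t
  proof -
    have "AE x in M. 2 * ?s x \<le> t * u x + v x / t"
      using nonneg by eventually_elim (rule weighted_am_gm_sqrt[OF _ _ that])
    then have "AE x in M. real_cond_exp M F (\<lambda>x. 2 * ?s x) x \<le> real_cond_exp M F (\<lambda>x. t * u x + v x / t) x"
      using int int_s by (intro real_cond_exp_mono) auto
    moreover have "AE x in M. real_cond_exp M F (\<lambda>x. t * u x + v x / t) x
        = real_cond_exp M F (\<lambda>x. t * u x) x + real_cond_exp M F (\<lambda>x. v x / t) x"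
      using int by (intro real_cond_exp_add) auto
    moreover note real_cond_exp_cmult[OF int_s, of 2] real_cond_exp_cmult[OF int(1), of t]
      real_cond_exp_cdiv[OF int(2), of t]
    ultimately show ?thesis
      by eventually_elim simp
  qed
  then have "AE x in M. \<forall>t\<in>{t\<in>\<rat>. 0 < t}.
      2 * real_cond_exp M F ?s x \<le> t * real_cond_exp M F u x + real_cond_exp M F v x / t"
    by (subst AE_ball_countable) (auto intro: countable_subset[OF _ countable_rat])
  moreover have "AE x in M. 0 \<le> ?s x"
    using nonneg by eventually_elim simp
  then have "AE x in M. 0 \<le> real_cond_exp M F ?s x"
    using int_s by (intro real_cond_exp_pos) auto
  moreover have "AE x in M. 0 \<le> real_cond_exp M F u x" "AE x in M. 0 \<le> real_cond_exp M F v x"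
    using int nonneg by (simp_all add: real_cond_exp_pos)
  ultimately show ?thesis
    by eventually_elim (rule square_le_mult_if_weighted_am_gm, auto)
qed

section \<open>Upward convergence along a filtration\<close>

locale exhausting_filtration = finite_measure M for M :: "'a measure" +
  fixes F :: "nat \<Rightarrow> 'a measure"
  assumes subalg: "\<And>n. subalgebra M (F n)"
    and mono: "\<And>m n. m \<le> n \<Longrightarrow> sets (F m) \<subseteq> sets (F n)"
    and generates: "sets M = sigma_sets (space M) (\<Union>n. sets (F n))"
begin

abbreviation cond_exp :: "nat \<Rightarrow> ('a \<Rightarrow> real) \<Rightarrow> 'a \<Rightarrow> real" where
  "cond_exp n \<equiv> real_cond_exp M (F n)"

sublocale level: finite_measure_subalgebra M "F n" for n
  by standard (rule subalg)

lemma subalgebra_le: "m \<le> n \<Longrightarrow> subalgebra (F n) (F m)"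
  using subalg[of m] subalg[of n] mono[of m n] by (auto simp: subalgebra_def)

text \<open>
  Doob's argument: split the event according to the first \<open>n\<close> at which the level \<open>c\<close> is reached. The
  corresponding piece lies in \<open>F n\<close>, so on it \<open>h\<close> and its conditional expectation, which is at least
  \<open>c\<close>, have the same integral.
\<close>
lemma maximal_inequality:
  assumes h: "integrable M h" "\<And>x. 0 \<le> h x" and c: "0 < c"
  shows "c * measure M {x\<in>space M. \<exists>n. c \<le> cond_exp n h x} \<le> (\<integral>x. h x \<partial>M)"
proof -
  define B where "B n = {x\<in>space M. c \<le> cond_exp n h x}" for n
  have B_F: "B n \<in> sets (F n)" for n
  proof -
    have "B n = {x\<in>space (F n). c \<le> cond_exp n h x}"
      using subalg[of n] by (simp add: B_def subalgebra_def)
    then show ?thesis by simp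
  qed
  define D where "D = disjointed B"
  have D_F: "D n \<in> sets (F n)" for n
    unfolding D_def disjointed_def using B_F mono[of _ n]
    by (intro sets.Diff sets.finite_UN) (auto intro: less_imp_le)
  have D_M [measurable]: "D n \<in> sets M" for n
    using D_F subalg[of n] by (auto simp: subalgebra_def)
  have disj: "disjoint_family D"
    unfolding D_def by (rule disjoint_family_disjointed)
  have union: "{x\<in>space M. \<exists>n. c \<le> cond_exp n h x} = (\<Union>n. D n)"
    unfolding D_def UN_disjointed_eq by (auto simp: B_def)
  have D_le: "c * measure M (D n) \<le> (\<integral>x. indicator (D n) x * h x \<partial>M)" for n
  proof -
    have int: "integrable M (\<lambda>x. indicator (D n) x * h x)"
      using integrable_mult_indicator[OF D_M h(1)] by simp
    note * = level.real_cond_exp_intg[OF int borel_measurable_indicator[OF D_F] borel_measurable_integrable[OF h(1)]]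
    have "c * measure M (D n) = (\<integral>x. indicator (D n) x * c \<partial>M)"
      by simp
    also have "\<dots> \<le> (\<integral>x. indicator (D n) x * cond_exp n h x \<partial>M)"
      using disjointed_subset[of B n]
      by (intro integral_mono *(1)) (auto simp: D_def[symmetric] B_def emeasure_eq_measure split: split_indicator)
    also have "\<dots> = (\<integral>x. indicator (D n) x * h x \<partial>M)"
      by (rule *(2))
    finally show ?thesis .
  qed
  have partial: "(\<Sum>n<N. c * measure M (D n)) \<le> (\<integral>x. h x \<partial>M)" for N
  proof -
    have int: "integrable M (\<lambda>x. indicator (D n) x * h x)" for n
      using integrable_mult_indicator[OF D_M h(1)] by simp
    have "(\<Sum>n<N. c * measure M (D n)) \<le> (\<Sum>n<N. \<integral>x. indicator (D n) x * h x \<partial>M)"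
      by (intro sum_mono D_le)
    also have "\<dots> = (\<integral>x. (\<Sum>n<N. indicator (D n) x * h x) \<partial>M)"
      using int by (intro Bochner_Integration.integral_sum[symmetric])
    also have "\<dots> \<le> (\<integral>x. h x \<partial>M)"
    proof (rule integral_mono)
      fix x
      have "(\<Sum>n<N. indicator (D n) x) = (indicator (\<Union>n<N. D n) x :: real)"
        using disj by (intro indicator_UN_disjoint[symmetric]) (auto simp: disjoint_family_on_def)
      then show "(\<Sum>n<N. indicator (D n) x * h x) \<le> h x"
        using h(2)[of x] by (simp add: sum_distrib_right[symmetric] split: split_indicator)
      show "integrable M (\<lambda>x. \<Sum>n<N. indicator (D n) x * h x)"
        using int by (intro Bochner_Integration.integrable_sum)
    qed (rule h(1))
    finally show ?thesis .
  qed
  have "(\<lambda>n. measure M (D n)) sums measure M (\<Union>n. D n)"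
    using disj by (intro finite_measure_UNION) auto
  then have "(\<lambda>n. c * measure M (D n)) sums (c * measure M (\<Union>n. D n))"
    by (rule sums_mult)
  then show ?thesis
    unfolding union sums_def by (rule LIMSEQ_le_const2) (use partial in auto)
qed

text \<open>
  The functions for which the claim holds form a linear space that is closed in \<open>L\<^sup>1\<close>, because
  conditional expectations are contractions. It contains every function that is measurable at some
  level of the filtration, since then the error is eventually \<open>0\<close>. A Dynkin argument extends this to
  indicators of all measurable sets, and hence to all integrable functions.
\<close>
lemma cond_exp_tendsto_L1:
  assumes "integrable M f"
  shows "(\<lambda>n. \<integral>x. \<bar>cond_exp n f x - f x\<bar> \<partial>M) \<longlonglongrightarrow> 0"
proof -
  define err where "err f n = (\<integral>x. \<bar>cond_exp n f x - f x\<bar> \<partial>M)" for f n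
  have err_nonneg: "0 \<le> err f n" for f n
    by (simp add: err_def)
  have int_ce: "integrable M (cond_exp n f)" if "integrable M f" for f n
    using that by (rule level.real_cond_exp_int)
  have err_add: "err (\<lambda>x. f x + g x) n \<le> err f n + err g n"
    if f: "integrable M f" and g: "integrable M g" for f g n
  proof -
    have "err (\<lambda>x. f x + g x) n \<le> (\<integral>x. \<bar>cond_exp n f x - f x\<bar> + \<bar>cond_exp n g x - g x\<bar> \<partial>M)"
      unfolding err_def
    proof (rule integral_mono_AE)
      show "AE x in M. \<bar>cond_exp n (\<lambda>x. f x + g x) x - (f x + g x)\<bar>
          \<le> \<bar>cond_exp n f x - f x\<bar> + \<bar>cond_exp n g x - g x\<bar>"
        using level.real_cond_exp_add[OF f g, of n] by eventually_elim auto
    qed (use f g int_ce in auto)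
    also have "\<dots> = err f n + err g n"
      unfolding err_def using f g int_ce by (intro Bochner_Integration.integral_add) auto
    finally show ?thesis .
  qed
  have err_cmult: "err (\<lambda>x. c * f x) n = \<bar>c\<bar> * err f n" if f: "integrable M f" for f c n
  proof -
    have "err (\<lambda>x. c * f x) n = (\<integral>x. \<bar>c\<bar> * \<bar>cond_exp n f x - f x\<bar> \<partial>M)"
      unfolding err_def
    proof (rule integral_cong_AE)
      show "AE x in M. \<bar>cond_exp n (\<lambda>x. c * f x) x - c * f x\<bar> = \<bar>c\<bar> * \<bar>cond_exp n f x - f x\<bar>"
        using level.real_cond_exp_cmult[OF f, of n c]
        by eventually_elim (auto simp: abs_mult[symmetric] algebra_simps)
    qed (use f in auto)
    then show ?thesis by (simp add: err_def)
  qed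
  have err_le: "err f n \<le> 2 * (\<integral>x. \<bar>f x\<bar> \<partial>M)" if f: "integrable M f" for f n
  proof -
    have "err f n \<le> (\<integral>x. \<bar>cond_exp n f x\<bar> + \<bar>f x\<bar> \<partial>M)"
      unfolding err_def using f int_ce by (intro integral_mono) auto
    also have "\<dots> = (\<integral>x. \<bar>cond_exp n f x\<bar> \<partial>M) + (\<integral>x. \<bar>f x\<bar> \<partial>M)"
      using f int_ce by (intro Bochner_Integration.integral_add) auto
    finally show ?thesis
      using level.integral_abs_real_cond_exp_le[OF f, of n] by linarith
  qed
  have closed: "err f \<longlonglongrightarrow> 0"
    if f: "integrable M f" and s: "\<And>i. integrable M (s i)" "\<And>i. err (s i) \<longlonglongrightarrow> 0"
      and s_f: "(\<lambda>i. \<integral>x. \<bar>f x - s i x\<bar> \<partial>M) \<longlonglongrightarrow> 0" for f and s :: "nat \<Rightarrow> 'a \<Rightarrow> real"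
  proof (rule LIMSEQ_I)
    fix e :: real assume e: "0 < e"
    then obtain i where i: "(\<integral>x. \<bar>f x - s i x\<bar> \<partial>M) < e / 4"
      using order_tendstoD(2)[OF s_f, of "e / 4"] by (auto simp: eventually_sequentially)
    obtain N where N: "\<And>n. N \<le> n \<Longrightarrow> err (s i) n < e / 2"
      using order_tendstoD(2)[OF s(2)[of i], of "e / 2"] e by (auto simp: eventually_sequentially)
    have "norm (err f n - 0) < e" if "N \<le> n" for n
    proof -
      have "err f n \<le> err (s i) n + err (\<lambda>x. f x - s i x) n"
        using err_add[OF s(1)[of i], of "\<lambda>x. f x - s i x" n] f s(1) by simp
      then show ?thesis
        using N[OF that] i err_le[of "\<lambda>x. f x - s i x" n] f s(1)[of i] err_nonneg[of f n] by auto
    qed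
    then show "\<exists>no. \<forall>n\<ge>no. norm (err f n - 0) < e" by blast
  qed
  have level_meas: "err f \<longlonglongrightarrow> 0" if f: "integrable M f" "f \<in> borel_measurable (F m)" for f m
  proof (rule tendsto_eventually, rule eventually_sequentiallyI)
    fix n assume "m \<le> n"
    then have "f \<in> borel_measurable (F n)"
      using f(2) subalgebra_le measurable_from_subalg by blast
    then have "AE x in M. cond_exp n f x = f x"
      using f(1) by (intro level.real_cond_exp_F_meas)
    then have "err f n = (\<integral>x. 0 \<partial>M)"
      unfolding err_def using f(1) by (intro integral_cong_AE) auto
    then show "err f n = 0" by simp
  qed
  have sum_tendsto: "err (\<lambda>x. f x + g x) \<longlonglongrightarrow> 0"
    if "integrable M f" "integrable M g" "err f \<longlonglongrightarrow> 0" "err g \<longlonglongrightarrow> 0" for f g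
  proof (rule tendsto_sandwich[OF always_eventually always_eventually tendsto_const])
    show "\<forall>n. 0 \<le> err (\<lambda>x. f x + g x) n" by (intro allI err_nonneg)
    show "\<forall>n. err (\<lambda>x. f x + g x) n \<le> err f n + err g n" by (intro allI err_add that)
    show "(\<lambda>n. err f n + err g n) \<longlonglongrightarrow> 0" using tendsto_add[OF that(3,4)] by simp
  qed
  have cmult_tendsto: "err (\<lambda>x. c * f x) \<longlonglongrightarrow> 0" if "integrable M f" "err f \<longlonglongrightarrow> 0" for c f
    unfolding err_cmult[OF that(1), abs_def] by (rule tendsto_mult_right_zero[OF that(2)])
  have ind: "err (indicator B) \<longlonglongrightarrow> 0" if "B \<in> sets M" for B
  proof -
    have Int_st: "Int_stable (\<Union>n. sets (F n))"
    proof (rule Int_stableI, clarsimp)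
      fix U V m n assume "U \<in> sets (F m)" "V \<in> sets (F n)"
      then have "U \<in> sets (F (max m n))" "V \<in> sets (F (max m n))"
        using mono[of m "max m n"] mono[of n "max m n"] by auto
      then show "\<exists>k. U \<inter> V \<in> sets (F k)" by blast
    qed
    have sub: "(\<Union>n. sets (F n)) \<subseteq> Pow (space M)"
      using subalg sets.space_closed[of M] by (fastforce simp: subalgebra_def)
    have "B \<in> sigma_sets (space M) (\<Union>n. sets (F n))"
      using that generates by simp
    with Int_st sub show ?thesis
    proof (induction rule: sigma_sets_induct_disjoint)
      case (basic B)
      then obtain n where "B \<in> sets (F n)" by blast
      then show ?case
        using subalg[of n] by (intro level_meas[of _ n]) (auto simp: subalgebra_def emeasure_eq_measure)
    next
      case empty
      show ?case
        by (intro level_meas[of _ 0]) auto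
    next
      case (compl B)
      have B [measurable]: "B \<in> sets M" using compl generates by simp
      have "err (\<lambda>x. indicator (space M) x + (-1) * indicator B x) \<longlonglongrightarrow> 0"
      proof (intro sum_tendsto cmult_tendsto)
        show "err (indicator (space M)) \<longlonglongrightarrow> 0"
          using subalg[of 0] sets.top[of "F 0"]
          by (intro level_meas[of _ 0]) (auto simp: emeasure_eq_measure subalgebra_def)
      qed (use compl in \<open>auto simp: emeasure_eq_measure\<close>)
      moreover have "err (indicator (space M - B)) n
          = err (\<lambda>x. indicator (space M) x + (-1) * indicator B x) n" for n
      proof -
        have eq: "indicator (space M - B) x = indicator (space M) x + (-1) * (indicator B x :: real)" for x
          using sets.sets_into_space[OF B] by (auto split: split_indicator)
        show ?thesis unfolding err_def eq ..
      qed
      ultimately show ?case by simp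
    next
      case (union D)
      have D [measurable]: "D i \<in> sets M" for i
        using union(2) generates by auto
      have int_D: "integrable M (indicator (D i) :: 'a \<Rightarrow> real)" for i
        by (auto simp: emeasure_eq_measure)
      let ?s = "\<lambda>N x. (\<Sum>i<N. indicator (D i) x) :: real"
      have s_eq: "?s N x = indicator (\<Union>i<N. D i) x" for N x
        using union(1) by (intro indicator_UN_disjoint[symmetric]) (auto simp: disjoint_family_on_def)
      show ?case
      proof (rule closed)
        show "integrable M (?s N)" for N
          using int_D by auto
        show "err (?s N) \<longlonglongrightarrow> 0" for N
        proof (induction N)
          case 0
          show ?case
            by (intro level_meas[of _ 0]) auto
        next
          case (Suc N)
          show ?case
            unfolding sum.lessThan_Suc
            using int_D union(3) Suc by (intro sum_tendsto) auto
        qed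
        have "(\<lambda>N. \<integral>x. \<bar>indicator (\<Union>i. D i) x - ?s N x\<bar> \<partial>M) \<longlonglongrightarrow> (\<integral>x. 0 \<partial>M)"
        proof (rule integral_dominated_convergence[where w = "\<lambda>x. 1"])
          show "AE x in M. (\<lambda>N. \<bar>indicator (\<Union>i. D i) x - ?s N x\<bar>) \<longlonglongrightarrow> 0"
          proof (rule AE_I2)
            fix x
            have "(\<lambda>N. indicator (\<Union>i<N. D i) x :: real) \<longlonglongrightarrow> indicator (\<Union>i. D i) x"
              by (rule LIMSEQ_indicator_UN)
            from tendsto_rabs[OF tendsto_diff[OF tendsto_const[of "indicator (\<Union>i. D i) x"] this]]
            show "(\<lambda>N. \<bar>indicator (\<Union>i. D i) x - ?s N x\<bar>) \<longlonglongrightarrow> 0"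
              by (simp add: s_eq)
          qed
          show "AE x in M. norm \<bar>indicator (\<Union>i. D i) x - ?s N x\<bar> \<le> 1" for N
            unfolding s_eq by (auto split: split_indicator)
        qed auto
        then show "(\<lambda>N. \<integral>x. \<bar>indicator (\<Union>i. D i) x - ?s N x\<bar> \<partial>M) \<longlonglongrightarrow> 0" by simp
      qed (auto simp: emeasure_eq_measure)
    qed
  qed
  have "err f \<longlonglongrightarrow> 0"
    using assms
  proof (induction rule: integrable_induct)
    case (base B c)
    have "err (\<lambda>x. c * indicator B x) \<longlonglongrightarrow> 0"
      using base ind by (intro cmult_tendsto) (auto simp: emeasure_eq_measure)
    then show ?case by (simp add: mult.commute)
  next
    case (add f g)
    then show ?case by (intro sum_tendsto)
  next
    case (lim f s)
    have [measurable]: "f \<in> borel_measurable M" "\<And>i. s i \<in> borel_measurable M"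
      using lim by auto
    have "(\<lambda>i. \<integral>x. \<bar>f x - s i x\<bar> \<partial>M) \<longlonglongrightarrow> (\<integral>x. 0 \<partial>M)"
    proof (rule integral_dominated_convergence[where w = "\<lambda>x. 3 * \<bar>f x\<bar>"])
      show "AE x in M. (\<lambda>i. \<bar>f x - s i x\<bar>) \<longlonglongrightarrow> 0"
      proof (rule AE_I2)
        fix x assume "x \<in> space M"
        from tendsto_rabs[OF tendsto_diff[OF tendsto_const[of "f x"] lim(2)[OF this]]]
        show "(\<lambda>i. \<bar>f x - s i x\<bar>) \<longlonglongrightarrow> 0" by simp
      qed
      show "AE x in M. norm \<bar>f x - s i x\<bar> \<le> 3 * \<bar>f x\<bar>" for i
      proof (rule AE_I2)
        fix x assume "x \<in> space M"
        then show "norm \<bar>f x - s i x\<bar> \<le> 3 * \<bar>f x\<bar>"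
          using lim(3)[of x i] \<open>x \<in> space M\<close> by simp
      qed
    qed (use lim in auto)
    then show ?case
      using lim by (intro closed[of f s]) auto
  qed
  then show ?thesis unfolding err_def[abs_def] .
qed

text \<open>
  Levy's upward theorem. For \<open>k \<ge> m\<close> the error of \<open>f\<close> at level \<open>k\<close> is at most \<open>E (h | F k) + h\<close> with
  \<open>h = \<bar>E (f | F m) - f\<bar>\<close>. The maximal inequality and Markov's inequality bound the measure of the set where
  this is ever large by a multiple of the integral of \<open>h\<close>, which tends to \<open>0\<close> as \<open>m\<close> grows.
\<close>
lemma cond_exp_tendsto_AE:
  assumes f: "integrable M f"
  shows "AE x in M. (\<lambda>n. cond_exp n f x) \<longlonglongrightarrow> f x"
proof -
  have [measurable]: "f \<in> borel_measurable M" using f by simp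
  \<comment> \<open>A level \<open>2 * c\<close> is reached by a sum of two terms only if one of them is at least \<open>c\<close>.\<close>
  define N where "N c = {x\<in>space M. \<forall>n. \<exists>k\<ge>n. 2 * c \<le> \<bar>cond_exp k f x - f x\<bar>}" for c :: real
  have N_M [measurable]: "N c \<in> sets M" for c
    unfolding N_def by measurable
  have N_null: "N c \<in> null_sets M" if c: "0 < c" for c
  proof -
    have "c * measure M (N c) \<le> 2 * (\<integral>x. \<bar>cond_exp m f x - f x\<bar> \<partial>M)" for m
    proof -
      define h where "h = (\<lambda>x. \<bar>cond_exp m f x - f x\<bar>)"
      have int_ce: "integrable M (cond_exp k f)" for k
        using f by (rule level.real_cond_exp_int)
      have int_d: "integrable M (\<lambda>x. cond_exp m f x - f x)"
        using f int_ce by auto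
      have int_h: "integrable M h"
        unfolding h_def using f int_ce by auto
      let ?A = "{x\<in>space M. \<exists>n. c \<le> cond_exp n h x}" and ?B = "{x\<in>space M. c \<le> h x}"
      have [measurable]: "h \<in> borel_measurable M" using int_h by simp
      have "AE x in M. m \<le> k \<longrightarrow> \<bar>cond_exp k f x - f x\<bar> \<le> cond_exp k h x + h x" for k
      proof (cases "m \<le> k")
        case True
        have "AE x in M. cond_exp k (cond_exp m f) x = cond_exp m f x"
          using True int_ce subalgebra_le[OF True] by (intro level.real_cond_exp_F_meas)
            (auto intro: measurable_from_subalg)
        moreover have "AE x in M. cond_exp k (\<lambda>x. cond_exp m f x - f x) x
            = cond_exp k (cond_exp m f) x - cond_exp k f x"
          using int_ce f by (intro level.real_cond_exp_diff)
        moreover have "AE x in M. \<bar>cond_exp k (\<lambda>x. cond_exp m f x - f x) x\<bar> \<le> cond_exp k h x"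
          using level.real_cond_exp_abs_le[OF int_d] by (simp add: h_def)
        ultimately show ?thesis
          by eventually_elim (auto simp: h_def)
      qed simp
      then have "AE x in M. \<forall>k. m \<le> k \<longrightarrow> \<bar>cond_exp k f x - f x\<bar> \<le> cond_exp k h x + h x"
        by (simp add: AE_all_countable)
      then have "AE x in M. x \<in> N c \<longrightarrow> x \<in> ?A \<union> ?B"
      proof eventually_elim
        case (elim x)
        show ?case
        proof
          assume x: "x \<in> N c"
          then obtain k where "m \<le> k" "2 * c \<le> \<bar>cond_exp k f x - f x\<bar>"
            by (auto simp: N_def)
          with elim have "2 * c \<le> cond_exp k h x + h x"
            by force
          then have "c \<le> cond_exp k h x \<or> c \<le> h x" by linarith
          then show "x \<in> ?A \<union> ?B" using x by (auto simp: N_def)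
        qed
      qed
      then have "measure M (N c) \<le> measure M (?A \<union> ?B)"
        by (intro finite_measure_mono_AE) auto
      also have "\<dots> \<le> measure M ?A + measure M ?B"
        by (intro measure_Un_le) auto
      finally have "c * measure M (N c) \<le> c * measure M ?A + c * measure M ?B"
        using c by (simp add: distrib_left[symmetric])
      also have "\<dots> \<le> (\<integral>x. h x \<partial>M) + (\<integral>x. h x \<partial>M)"
      proof (intro add_mono)
        show "c * measure M ?A \<le> (\<integral>x. h x \<partial>M)"
          using int_h c by (intro maximal_inequality) (auto simp: h_def)
        show "c * measure M ?B \<le> (\<integral>x. h x \<partial>M)"
          using integral_Markov_inequality_measure[OF int_h, of "space M" c] c
          by (auto simp: h_def field_simps)
      qed
      finally show ?thesis by (simp add: h_def)
    qed
    then have "c * measure M (N c) \<le> 2 * 0"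
      by (intro LIMSEQ_le_const[OF tendsto_mult_left[OF cond_exp_tendsto_L1[OF f], of 2]]) blast
    then have "measure M (N c) = 0"
      using c by (simp add: mult_le_0_iff measure_le_0_iff)
    then show ?thesis
      by (simp add: emeasure_eq_measure null_setsI)
  qed
  have "AE x in M. \<forall>j. x \<notin> N (inverse (real (Suc j)))"
    unfolding AE_all_countable by (intro allI AE_not_in N_null) simp
  with AE_space show ?thesis
  proof eventually_elim
    case (elim x)
    show ?case
    proof (rule LIMSEQ_I)
      fix e :: real assume "0 < e"
      then obtain j where j: "inverse (real (Suc j)) < e / 2"
        using reals_Archimedean[of "e / 2"] by auto
      from elim obtain n where "\<And>k. n \<le> k \<Longrightarrow> \<bar>cond_exp k f x - f x\<bar> < 2 * inverse (real (Suc j))"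
        unfolding N_def by (simp add: not_le) (meson not_le)
      with j show "\<exists>no. \<forall>n\<ge>no. norm (cond_exp n f x - f x) < e"
        by (intro exI[of _ n]) (force intro: less_trans)
    qed
  qed
qed

end

lemma sqrt_diff_square_le:
  fixes x y :: real
  assumes "0 \<le> x" "0 \<le> y"
  shows "(sqrt x - sqrt y)\<^sup>2 \<le> \<bar>x - y\<bar>"
proof -
  have "(sqrt x - sqrt y)\<^sup>2 = \<bar>sqrt x - sqrt y\<bar> * \<bar>sqrt x - sqrt y\<bar>"
    by (simp add: power2_eq_square)
  also have "\<dots> \<le> \<bar>sqrt x - sqrt y\<bar> * (sqrt x + sqrt y)"
    using assms by (intro mult_left_mono) (auto simp: abs_le_iff)
  also have "\<dots> = \<bar>(sqrt x - sqrt y) * (sqrt x + sqrt y)\<bar>"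
    using assms by (simp add: abs_mult)
  also have "\<dots> = \<bar>x - y\<bar>"
    using assms by (simp add: algebra_simps)
  finally show ?thesis .
qed

lemma (in exhausting_filtration) sqrt_cond_exp_tendsto_L2:
  assumes g: "integrable M g" "\<And>x. 0 \<le> g x"
  shows "(\<lambda>n. sqrt (\<integral>x. (sqrt (cond_exp n g x) - sqrt (g x))\<^sup>2 \<partial>M)) \<longlonglongrightarrow> 0"
proof -
  have int: "integrable M (\<lambda>x. \<bar>cond_exp n g x - g x\<bar>)" for n
    using g level.real_cond_exp_int(1)[OF g(1)] by auto
  have [measurable]: "g \<in> borel_measurable M" using g by auto
  have le: "AE x in M. (sqrt (cond_exp n g x) - sqrt (g x))\<^sup>2 \<le> \<bar>cond_exp n g x - g x\<bar>" for n
  proof -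
    have "AE x in M. 0 \<le> cond_exp n g x"
      using g by (intro level.real_cond_exp_pos) auto
    then show ?thesis
      by eventually_elim (intro sqrt_diff_square_le g)
  qed
  have "integrable M (\<lambda>x. (sqrt (cond_exp n g x) - sqrt (g x))\<^sup>2)" for n
    by (rule Bochner_Integration.integrable_bound[OF int[of n]]) (use le[of n] in auto)
  then have "(\<integral>x. (sqrt (cond_exp n g x) - sqrt (g x))\<^sup>2 \<partial>M) \<le> (\<integral>x. \<bar>cond_exp n g x - g x\<bar> \<partial>M)" for n
    using int le by (intro integral_mono_AE)
  then have "(\<lambda>n. \<integral>x. (sqrt (cond_exp n g x) - sqrt (g x))\<^sup>2 \<partial>M) \<longlonglongrightarrow> 0"
    by (intro tendsto_sandwich[OF _ _ tendsto_const cond_exp_tendsto_L1[OF g(1)]]) auto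
  from tendsto_real_sqrt[OF this] show ?thesis by simp
qed

section \<open>The Hellinger quotient\<close>

text \<open>
  The delicate points are those with \<open>a * b = 0\<close>, where the quotient has the indeterminate form
  \<open>0 / 0\<close>. With \<open>u\<close> and \<open>v\<close> the restrictions of \<open>a\<close> and \<open>b\<close> to \<open>{a * b > 0}\<close>, Cauchy-Schwarz bounds its
  square by \<open>(u\<^sub>n / a\<^sub>n) * (v\<^sub>n / b\<^sub>n)\<close>. Both factors are at most \<open>1\<close>. Since one of \<open>a\<close>, \<open>b\<close> is positive,
  one of the denominators has a positive limit while its numerator tends to \<open>0\<close>.
\<close>
lemma (in exhausting_filtration) hellinger_quotient_tendsto:
  assumes int: "integrable M a" "integrable M b"
    and nonneg: "\<And>x. 0 \<le> a x" "\<And>x. 0 \<le> b x"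
    and one_pos: "AE x in M. 0 < a x \<or> 0 < b x"
    and pos: "\<And>n. AE x in M. 0 < cond_exp n a x" "\<And>n. AE x in M. 0 < cond_exp n b x"
  shows "AE x in M. (\<lambda>n. cond_exp n (\<lambda>x. sqrt (a x * b x)) x / sqrt (cond_exp n a x * cond_exp n b x))
      \<longlonglongrightarrow> (if 0 < a x \<and> 0 < b x then 1 else 0)"
proof -
  let ?s = "\<lambda>x. sqrt (a x * b x)"
  have int_s: "integrable M ?s"
    using int nonneg by (intro integrable_sqrt_mult) auto
  have [measurable]: "a \<in> borel_measurable M" "b \<in> borel_measurable M" using int by auto
  define u where "u x = (if 0 < a x \<and> 0 < b x then a x else 0)" for x
  define v where "v x = (if 0 < a x \<and> 0 < b x then b x else 0)" for x
  have [measurable]: "u \<in> borel_measurable M" "v \<in> borel_measurable M"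
    unfolding u_def v_def by measurable
  have uv_bounds: "0 \<le> u x" "0 \<le> v x" "u x \<le> a x" "v x \<le> b x" for x
    using nonneg[of x] by (auto simp: u_def v_def)
  have int_u: "integrable M u"
    by (rule Bochner_Integration.integrable_bound[OF int(1)]) (use uv_bounds nonneg in auto)
  have int_v: "integrable M v"
    by (rule Bochner_Integration.integrable_bound[OF int(2)]) (use uv_bounds nonneg in auto)
  have s_uv: "?s = (\<lambda>x. sqrt (u x * v x))"
    using nonneg by (auto simp: u_def v_def fun_eq_iff less_le)
  have CS: "AE x in M. (cond_exp n ?s x)\<^sup>2 \<le> cond_exp n u x * cond_exp n v x" for n
    unfolding s_uv using int_u int_v uv_bounds by (intro level.real_cond_exp_Cauchy_Schwarz) auto
  have mono_u: "AE x in M. cond_exp n u x \<le> cond_exp n a x" for n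
    using int_u int uv_bounds by (intro level.real_cond_exp_mono) auto
  have mono_v: "AE x in M. cond_exp n v x \<le> cond_exp n b x" for n
    using int_v int uv_bounds by (intro level.real_cond_exp_mono) auto
  have ge0: "AE x in M. 0 \<le> cond_exp n u x" "AE x in M. 0 \<le> cond_exp n v x"
    "AE x in M. 0 \<le> cond_exp n ?s x" for n
    using uv_bounds int_s nonneg by (auto intro!: level.real_cond_exp_pos)
  have "AE x in M. \<forall>n. 0 < cond_exp n a x \<and> 0 < cond_exp n b x \<and> 0 \<le> cond_exp n u x \<and>
     0 \<le> cond_exp n v x \<and> 0 \<le> cond_exp n ?s x \<and> cond_exp n u x \<le> cond_exp n a x \<and>
     cond_exp n v x \<le> cond_exp n b x \<and> (cond_exp n ?s x)\<^sup>2 \<le> cond_exp n u x * cond_exp n v x"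
    unfolding AE_all_countable using pos ge0 mono_u mono_v CS by auto
  moreover note one_pos cond_exp_tendsto_AE[OF int(1)] cond_exp_tendsto_AE[OF int(2)]
    cond_exp_tendsto_AE[OF int_s] cond_exp_tendsto_AE[OF int_u] cond_exp_tendsto_AE[OF int_v]
  ultimately show ?thesis
  proof eventually_elim
    case (elim x)
    let ?q = "\<lambda>n. cond_exp n ?s x / sqrt (cond_exp n a x * cond_exp n b x)"
    have an: "0 < cond_exp n a x" and bn: "0 < cond_exp n b x" and un: "0 \<le> cond_exp n u x"
      and vn: "0 \<le> cond_exp n v x" and sn: "0 \<le> cond_exp n ?s x"
      and una: "cond_exp n u x \<le> cond_exp n a x" and vnb: "cond_exp n v x \<le> cond_exp n b x"
      and cs: "(cond_exp n ?s x)\<^sup>2 \<le> cond_exp n u x * cond_exp n v x" for n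
      using elim(1) by auto
    show ?case
    proof (cases "0 < a x \<and> 0 < b x")
      case True
      have "?q \<longlonglongrightarrow> ?s x / sqrt (a x * b x)"
        using True by (intro tendsto_intros elim) auto
      then show ?thesis using True by simp
    next
      case False
      then have uv0: "u x = 0" "v x = 0" by (auto simp: u_def v_def)
      have q0: "0 \<le> ?q n" for n
        using sn by (simp add: an bn less_imp_le)
      have "\<exists>r. r \<longlonglongrightarrow> 0 \<and> (\<forall>n. (?q n)\<^sup>2 \<le> r n)"
      proof -
        have q2: "(?q n)\<^sup>2 \<le> (cond_exp n u x / cond_exp n a x) * (cond_exp n v x / cond_exp n b x)" for n
          using cs[of n] an[of n] bn[of n] by (simp add: power_divide divide_right_mono)
        have ratio1: "cond_exp n u x / cond_exp n a x \<le> 1" "0 \<le> cond_exp n u x / cond_exp n a x"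
          "cond_exp n v x / cond_exp n b x \<le> 1" "0 \<le> cond_exp n v x / cond_exp n b x" for n
          using an bn un vn una vnb by (simp_all add: less_imp_le)
        show ?thesis
        proof (cases "0 < a x")
          case True
          have "(\<lambda>n. cond_exp n u x / cond_exp n a x) \<longlonglongrightarrow> u x / a x"
            using True by (intro tendsto_intros elim) auto
          moreover have "(?q n)\<^sup>2 \<le> cond_exp n u x / cond_exp n a x" for n
            using q2[of n] mult_left_le[OF ratio1(3,2)[of n]] by linarith
          ultimately show ?thesis using uv0 by auto
        next
          case False
          then have "0 < b x" using elim(2) by simp
          then have "(\<lambda>n. cond_exp n v x / cond_exp n b x) \<longlonglongrightarrow> v x / b x"
            by (intro tendsto_intros elim) auto
          moreover have "(?q n)\<^sup>2 \<le> cond_exp n v x / cond_exp n b x" for n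
            using q2[of n] mult_right_le_one_le[OF ratio1(4,2,1)[of n]] by (simp add: mult.commute)
          ultimately show ?thesis using uv0 by auto
        qed
      qed
      then obtain r where r: "r \<longlonglongrightarrow> 0" "\<And>n. (?q n)\<^sup>2 \<le> r n" by blast
      have "(\<lambda>n. (?q n)\<^sup>2) \<longlonglongrightarrow> 0"
        by (rule tendsto_sandwich[OF _ _ tendsto_const r(1)]) (auto simp: r(2))
      then have "(\<lambda>n. sqrt ((?q n)\<^sup>2)) \<longlonglongrightarrow> sqrt 0"
        by (rule tendsto_real_sqrt)
      then have "?q \<longlonglongrightarrow> 0"
        by (simp only: real_sqrt_abs abs_of_nonneg[OF q0] real_sqrt_zero)
      then show ?thesis using False by auto
    qed
  qed
qed

section \<open>Densities with respect to the sum of two measures\<close>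

lemma finite_measure_sum_measure:
  assumes "finite_measure P" "finite_measure P'" "sets P' = sets P"
  shows "finite_measure (sum_measure P P')"
proof (rule finite_measureI)
  interpret P: finite_measure P by fact
  interpret P': finite_measure P' by fact
  have "space P' = space P" by (rule sets_eq_imp_space_eq[OF assms(3)])
  then show "emeasure (sum_measure P P') (space (sum_measure P P')) \<noteq> \<infinity>"
    using P.emeasure_finite P'.emeasure_finite[of "space P"]
    by (simp add: emeasure_sum_measure[OF assms(3)])
qed

text \<open>
  The two Radon-Nikodym derivatives add up to \<open>1\<close> almost everywhere. Truncation gives a version with
  values in \<open>[0, 1]\<close> everywhere, so that the second density can be taken to be exactly \<open>1 - a\<close>.
\<close>
lemma sum_measure_densities:
  assumes fin: "finite_measure P" "finite_measure P'" and sets: "sets P' = sets P"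
  obtains a :: "'a \<Rightarrow> real" where "a \<in> borel_measurable (sum_measure P P')"
    "\<And>x. 0 \<le> a x" "\<And>x. a x \<le> 1"
    "P = density (sum_measure P P') (\<lambda>x. ennreal (a x))"
    "P' = density (sum_measure P P') (\<lambda>x. ennreal (1 - a x))"
proof -
  let ?R = "sum_measure P P'"
  interpret R: finite_measure ?R by (rule finite_measure_sum_measure) fact+
  have null: "A \<in> null_sets P \<and> A \<in> null_sets P'" if "A \<in> null_sets ?R" for A
    using that by (auto simp: null_sets_def emeasure_sum_measure[OF sets] sets)
  have ac: "absolutely_continuous ?R P" "absolutely_continuous ?R P'"
    using null by (auto simp: absolutely_continuous_def)
  define f where "f = RN_deriv ?R P"
  define g where "g = RN_deriv ?R P'"
  have f_meas [measurable]: "f \<in> borel_measurable ?R" and g_meas [measurable]: "g \<in> borel_measurable ?R"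
    unfolding f_def g_def by (rule borel_measurable_RN_deriv)+
  have df: "density ?R f = P"
    unfolding f_def by (rule R.density_RN_deriv[OF ac(1)]) simp
  have dg: "density ?R g = P'"
    unfolding g_def by (rule R.density_RN_deriv[OF ac(2)]) (simp add: sets)
  have "density ?R (\<lambda>x. f x + g x) = density ?R (\<lambda>x. 1)"
  proof (rule measure_eqI)
    fix A assume "A \<in> sets (density ?R (\<lambda>x. f x + g x))"
    then have A [measurable]: "A \<in> sets ?R" by simp
    have "emeasure (density ?R (\<lambda>x. f x + g x)) A = emeasure (density ?R f) A + emeasure (density ?R g) A"
      using A by (subst (1 2 3) emeasure_density)
         (auto simp: distrib_right intro!: nn_integral_add)
    also have "\<dots> = emeasure ?R A"
      unfolding df dg using A by (simp add: emeasure_sum_measure[OF sets])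
    finally show "emeasure (density ?R (\<lambda>x. f x + g x)) A = emeasure (density ?R (\<lambda>x. 1)) A"
      by (simp add: density_1)
  qed simp
  then have fg: "AE x in ?R. f x + g x = 1"
    by (rule R.density_unique[rotated 2]) auto
  define a where "a x = min 1 (enn2real (f x))" for x
  have a_meas [measurable]: "a \<in> borel_measurable ?R"
    unfolding a_def by measurable
  have a_bounds: "0 \<le> a x" "a x \<le> 1" for x
    by (auto simp: a_def)
  have eq: "ennreal (a x) = f x \<and> ennreal (1 - a x) = g x" if sum: "f x + g x = 1" for x
  proof -
    have "f x \<noteq> \<top>" "g x \<noteq> \<top>" using sum by auto
    then obtain r s where rs: "f x = ennreal r" "0 \<le> r" "g x = ennreal s" "0 \<le> s"
      by (metis ennreal_cases)
    with sum have "r + s = 1"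
      by (simp add: ennreal_plus[symmetric] del: ennreal_plus)
    with rs show ?thesis by (auto simp: a_def min_def)
  qed
  have "density ?R (\<lambda>x. ennreal (a x)) = density ?R f"
    using fg by (intro density_cong) (auto elim!: eventually_mono dest: eq)
  moreover have "density ?R (\<lambda>x. ennreal (1 - a x)) = density ?R g"
    using fg by (intro density_cong) (auto elim!: eventually_mono dest: eq)
  ultimately show ?thesis
    using that[of a] a_meas a_bounds df dg by simp
qed

lemma nn_integral_positive_restr_RN_version:
  assumes "finite_measure P" and sets: "sets P' = sets P" and sub: "subalgebra P G"
    and mac: "mutually_absolutely_continuous (restr_to_subalg P G) (restr_to_subalg P' G)"
    and version: "positive_restr_RN_version P P' G f"
    and g [measurable]: "g \<in> borel_measurable G"
  shows "(\<integral>\<^sup>+x. g x \<partial>P') = (\<integral>\<^sup>+x. ennreal (f x) * g x \<partial>P)"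
proof -
  interpret rP: finite_measure "restr_to_subalg P G"
    using sub assms(1) by (rule finite_measure_restr_to_subalg)
  have sub': "subalgebra P' G"
    using sub sets sets_eq_imp_space_eq[OF sets] by (simp add: subalgebra_def)
  have f [measurable]: "f \<in> borel_measurable G"
    and f_eq: "AE x in restr_to_subalg P G.
      ennreal (f x) = RN_deriv (restr_to_subalg P G) (restr_to_subalg P' G) x"
    using version by (auto simp: positive_restr_RN_version_def)
  have "(\<integral>\<^sup>+x. g x \<partial>P') = (\<integral>\<^sup>+x. g x \<partial>restr_to_subalg P' G)"
    by (rule nn_integral_subalgebra2[OF sub' g, symmetric])
  also have "\<dots> = (\<integral>\<^sup>+x. RN_deriv (restr_to_subalg P G) (restr_to_subalg P' G) x * g x \<partial>restr_to_subalg P G)"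
    using mac by (intro rP.RN_deriv_nn_integral measurable_in_subalg[OF sub])
      (auto simp: mutually_absolutely_continuous_def sets_restr_to_subalg[OF sub] sets_restr_to_subalg[OF sub'])
  also have "\<dots> = (\<integral>\<^sup>+x. ennreal (f x) * g x \<partial>restr_to_subalg P G)"
    using f_eq by (intro nn_integral_cong_AE) (auto elim!: eventually_mono)
  also have "\<dots> = (\<integral>\<^sup>+x. ennreal (f x) * g x \<partial>P)"
    by (intro nn_integral_subalgebra2[OF sub]) measurable
  finally show ?thesis .
qed

section \<open>Conditional Hellinger integrals of two dominated measures\<close>

text \<open>
  The function \<open>f\<close> is a positive \<open>G\<close>-measurable density of the restriction of \<open>P'\<close> to \<open>G\<close> with
  respect to that of \<open>P\<close>. The
  change-of-measure formula is used instead of the restricted measures because it concerns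
  integrals with respect to \<open>P\<close> and \<open>P'\<close> themselves.
\<close>
definition restr_density :: "'a measure \<Rightarrow> 'a measure \<Rightarrow> 'a measure \<Rightarrow> ('a \<Rightarrow> real) \<Rightarrow> bool" where
  "restr_density P P' G f \<longleftrightarrow> f \<in> borel_measurable G \<and> (\<forall>x\<in>space G. 0 < f x) \<and>
    (\<forall>g\<in>borel_measurable G. (\<integral>\<^sup>+x. g x \<partial>P') = (\<integral>\<^sup>+x. ennreal (f x) * g x \<partial>P))"

text \<open>
  Two instances matter: the symmetric one with \<open>R\<close> the sum of \<open>P\<close> and \<open>P'\<close>, and, when \<open>P'\<close> has a
  density with respect to \<open>P\<close>, the one with \<open>R = P\<close> and \<open>a = 1\<close>.
\<close>
locale dominated_pair = finite_measure R for R :: "'a measure" +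
  fixes a b :: "'a \<Rightarrow> real" and P P' :: "'a measure"
  assumes a_int: "integrable R a" and b_int: "integrable R b"
    and a_nonneg: "\<And>x. 0 \<le> a x" and b_nonneg: "\<And>x. 0 \<le> b x"
    and one_pos: "AE x in R. 0 < a x \<or> 0 < b x"
    and P_eq: "P = density R (\<lambda>x. ennreal (a x))"
    and P'_eq: "P' = density R (\<lambda>x. ennreal (b x))"
begin

lemma meas [measurable]: "a \<in> borel_measurable R" "b \<in> borel_measurable R"
  using a_int b_int by auto

lemma sets_P [simp, measurable_cong]: "sets P = sets R" "sets P' = sets R"
  by (simp_all add: P_eq P'_eq)

lemma space_P [simp]: "space P = space R" "space P' = space R"
  by (simp_all add: P_eq P'_eq)

lemma finite_measure_P: "finite_measure P" "finite_measure P'"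
  using a_int b_int a_nonneg b_nonneg
  by (auto intro!: finite_measureI simp: P_eq P'_eq emeasure_density nn_integral_eq_integral cong: nn_integral_cong_simp)

lemma integral_P:
  fixes f :: "'a \<Rightarrow> real"
  assumes "f \<in> borel_measurable R"
  shows "(\<integral>x. f x \<partial>P) = (\<integral>x. a x * f x \<partial>R)" "(\<integral>x. f x \<partial>P') = (\<integral>x. b x * f x \<partial>R)"
  using assms a_nonneg b_nonneg by (simp_all add: P_eq P'_eq integral_density)

lemma integrable_P:
  fixes f :: "'a \<Rightarrow> real"
  assumes "f \<in> borel_measurable R"
  shows "integrable P f \<longleftrightarrow> integrable R (\<lambda>x. a x * f x)"
  using assms a_nonneg by (simp add: P_eq integrable_density)

lemma subalgebra_P: "subalgebra R G \<Longrightarrow> subalgebra P G"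
  by (simp add: subalgebra_def)

lemma finite_measure_subalgebra_R: "subalgebra R G \<Longrightarrow> finite_measure_subalgebra R G"
  by (simp add: finite_measure_subalgebra_def finite_measure_subalgebra_axioms_def finite_measure_axioms)

lemma finite_measure_subalgebra_P: "subalgebra R G \<Longrightarrow> finite_measure_subalgebra P G"
  by (simp add: finite_measure_subalgebra_def finite_measure_subalgebra_axioms_def finite_measure_P subalgebra_P)

text \<open>
  Both sides have the same integral over each \<open>B\<close> in \<open>G\<close>: integrals under \<open>P\<close> are integrals under \<open>R\<close>
  with weight \<open>a\<close>, and \<open>a\<close> may be replaced by its conditional expectation against a
  \<open>G\<close>-measurable factor.
\<close>
lemma Bayes:
  assumes G: "subalgebra R G" and Z: "integrable P Z"
  shows "AE x in R. real_cond_exp R G (\<lambda>x. Z x * a x) x = real_cond_exp P G Z x * real_cond_exp R G a x"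
proof -
  interpret G: finite_measure_subalgebra R G by (rule finite_measure_subalgebra_R) fact
  interpret GP: finite_measure_subalgebra P G by (rule finite_measure_subalgebra_P) fact
  have [measurable]: "Z \<in> borel_measurable R"
    using borel_measurable_integrable[OF Z] by simp
  have ce_meas [measurable]: "real_cond_exp P G Z \<in> borel_measurable R"
    using borel_measurable_cond_exp2[of P G Z] by simp
  have int_ce: "integrable R (\<lambda>x. real_cond_exp P G Z x * a x)"
    using GP.real_cond_exp_int(1)[OF Z] integrable_P[OF ce_meas] by (simp add: mult.commute)
  show ?thesis
  proof (rule G.real_cond_exp_charact)
    fix B assume B: "B \<in> sets G"
    then have B_R [measurable]: "B \<in> sets R" using G by (auto simp: subalgebra_def)
    have B_meas [measurable]: "indicator B \<in> borel_measurable G" using B by simp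
    have int_B: "integrable R (\<lambda>x. (indicator B x * real_cond_exp P G Z x) * a x)"
      using integrable_mult_indicator[OF B_R int_ce] by (simp add: mult.assoc)
    have "(\<integral>x\<in>B. Z x * a x \<partial>R) = (\<integral>x\<in>B. Z x \<partial>P)"
      unfolding set_lebesgue_integral_def by (subst integral_P) (auto simp: ac_simps)
    also have "\<dots> = (\<integral>x\<in>B. real_cond_exp P G Z x \<partial>P)"
      using Z B by (rule GP.real_cond_exp_intA)
    also have "\<dots> = (\<integral>x. (indicator B x * real_cond_exp P G Z x) * a x \<partial>R)"
      unfolding set_lebesgue_integral_def by (subst integral_P) (auto simp: ac_simps)
    also have "\<dots> = (\<integral>x. (indicator B x * real_cond_exp P G Z x) * real_cond_exp R G a x \<partial>R)"
      using int_B by (intro G.real_cond_exp_intg(2)[symmetric]) auto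
    also have "\<dots> = (\<integral>x\<in>B. real_cond_exp P G Z x * real_cond_exp R G a x \<partial>R)"
      unfolding set_lebesgue_integral_def by (simp add: mult.assoc)
    finally show "(\<integral>x\<in>B. Z x * a x \<partial>R) = (\<integral>x\<in>B. real_cond_exp P G Z x * real_cond_exp R G a x \<partial>R)" .
  next
    show "integrable R (\<lambda>x. Z x * a x)"
      using Z by (simp add: integrable_P mult.commute)
    show "integrable R (\<lambda>x. real_cond_exp P G Z x * real_cond_exp R G a x)"
      using int_ce by (intro G.real_cond_exp_intg(1)) auto
  qed measurable
qed

lemma integrable_restr_density:
  assumes G: "subalgebra R G" and f: "restr_density P P' G f"
  shows "integrable P f"
proof (rule integrableI_nonneg)
  have sp: "space G = space R" using G by (simp add: subalgebra_def)
  have "f \<in> borel_measurable G" using f by (simp add: restr_density_def)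
  then show "f \<in> borel_measurable P"
    using subalgebra_P[OF G] by (rule measurable_from_subalg[rotated])
  show "AE x in P. 0 \<le> f x"
    using f by (intro AE_I2) (auto simp: restr_density_def sp less_imp_le)
  have "(\<integral>\<^sup>+x. 1 \<partial>P') = (\<integral>\<^sup>+x. ennreal (f x) * 1 \<partial>P)"
    using f unfolding restr_density_def by (elim conjE bspec) simp
  then show "(\<integral>\<^sup>+x. ennreal (f x) \<partial>P) < \<infinity>"
    using finite_measure.emeasure_finite[OF finite_measure_P(2), of "space R"]
    by (simp add: less_top)
qed

lemma cond_exp_likelihood_ratio:
  assumes G: "subalgebra R G" and f: "restr_density P P' G f"
  shows "AE x in R. real_cond_exp R G b x = f x * real_cond_exp R G a x"
proof -
  interpret G: finite_measure_subalgebra R G by (rule finite_measure_subalgebra_R) fact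
  have sp: "space G = space R" using G by (simp add: subalgebra_def)
  have f_meas [measurable]: "f \<in> borel_measurable G" using f by (simp add: restr_density_def)
  have [measurable]: "f \<in> borel_measurable R" by (rule measurable_from_subalg[OF G f_meas])
  have f_pos: "x \<in> space R \<Longrightarrow> 0 \<le> f x" for x using f by (auto simp: restr_density_def sp less_imp_le)
  have int_f: "integrable R (\<lambda>x. f x * a x)"
    using integrable_restr_density[OF assms] by (simp add: integrable_P mult.commute)
  show ?thesis
  proof (rule G.real_cond_exp_charact)
    fix B assume B: "B \<in> sets G"
    then have B_R [measurable]: "B \<in> sets R" using G by (auto simp: subalgebra_def)
    have B_meas [measurable]: "indicator B \<in> borel_measurable G" using B by simp
    have "(\<integral>\<^sup>+x. indicator B x \<partial>P') = (\<integral>\<^sup>+x. ennreal (f x) * indicator B x \<partial>P)"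
      using f B unfolding restr_density_def by (elim conjE bspec) simp
    then have em: "emeasure P' B = (\<integral>\<^sup>+x. ennreal (f x * indicator B x) \<partial>P)"
      by (simp add: ennreal_mult'' ennreal_indicator)
    have "(\<integral>x\<in>B. b x \<partial>R) = (\<integral>x. indicator B x \<partial>P')"
      unfolding set_lebesgue_integral_def by (subst integral_P) (auto simp: ac_simps)
    also have "\<dots> = (\<integral>x. f x * indicator B x \<partial>P)"
      using em f_pos by (subst integral_eq_nn_integral) (auto simp: measure_def intro!: AE_I2)
    also have "\<dots> = (\<integral>x. (indicator B x * f x) * a x \<partial>R)"
      by (subst integral_P) (auto simp: ac_simps)
    also have "\<dots> = (\<integral>x. (indicator B x * f x) * real_cond_exp R G a x \<partial>R)"
      using integrable_mult_indicator[OF B_R int_f]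
      by (intro G.real_cond_exp_intg(2)[symmetric]) (auto simp: mult.assoc)
    also have "\<dots> = (\<integral>x\<in>B. f x * real_cond_exp R G a x \<partial>R)"
      unfolding set_lebesgue_integral_def by (simp add: mult.assoc)
    finally show "(\<integral>x\<in>B. b x \<partial>R) = (\<integral>x\<in>B. f x * real_cond_exp R G a x \<partial>R)" .
  next
    show "integrable R (\<lambda>x. f x * real_cond_exp R G a x)"
      using int_f by (intro G.real_cond_exp_intg(1)) auto
  qed (rule b_int, measurable)
qed

text \<open>
  The set where \<open>E (a | G)\<close> vanishes lies in \<open>G\<close> and is \<open>P\<close>-null, hence \<open>P'\<close>-null by the density \<open>f\<close>. So
  both \<open>a\<close> and \<open>b\<close> vanish on it, which is possible only on an \<open>R\<close>-null set.
\<close>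
lemma cond_exp_densities_pos:
  assumes G: "subalgebra R G" and f: "restr_density P P' G f"
  shows "AE x in R. 0 < real_cond_exp R G a x \<and> 0 < real_cond_exp R G b x"
proof -
  interpret G: finite_measure_subalgebra R G by (rule finite_measure_subalgebra_R) fact
  have sp: "space G = space R" using G by (simp add: subalgebra_def)
  define N where "N = {x\<in>space G. real_cond_exp R G a x \<le> 0}"
  have N: "N \<in> sets G" unfolding N_def by measurable
  have N_R [measurable]: "N \<in> sets R" using N G by (auto simp: subalgebra_def)
  have int_N: "integrable R (\<lambda>x. indicator N x * a x)"
    using integrable_mult_indicator[OF N_R a_int] by simp
  have "(\<integral>x. indicator N x * a x \<partial>R) = (\<integral>x. indicator N x * real_cond_exp R G a x \<partial>R)"
    using int_N N by (intro G.real_cond_exp_intg(2)[symmetric]) auto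
  also have "\<dots> \<le> (\<integral>x. 0 \<partial>R)"
    using G.real_cond_exp_intg(1)[OF int_N] N
    by (intro integral_mono) (auto simp: N_def split: split_indicator)
  finally have "(\<integral>x. indicator N x * a x \<partial>R) = 0"
    using a_nonneg by (intro antisym) auto
  then have a0: "AE x in R. indicator N x * a x = 0"
    using int_N a_nonneg by (subst (asm) integral_nonneg_eq_0_iff_AE) auto
  have "(\<integral>\<^sup>+x. indicator N x \<partial>P') = (\<integral>\<^sup>+x. ennreal (f x) * indicator N x \<partial>P)"
    using f N unfolding restr_density_def by (elim conjE bspec) simp
  also have "\<dots> = (\<integral>\<^sup>+x. 0 \<partial>P)"
  proof (rule nn_integral_cong_AE)
    show "AE x in P. ennreal (f x) * indicator N x = 0"
      unfolding P_eq using a0 by (subst AE_density) (auto elim!: eventually_mono split: split_indicator)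
  qed
  finally have "emeasure P' N = 0" by simp
  then have "AE x in P'. x \<notin> N"
    by (intro AE_not_in null_setsI) auto
  then have "AE x in R. 0 < b x \<longrightarrow> x \<notin> N"
    unfolding P'_eq by (subst (asm) AE_density) auto
  then have "AE x in R. 0 < real_cond_exp R G a x"
    using a0 one_pos AE_space
    by eventually_elim (auto simp: N_def sp split: split_indicator_asm)
  then show ?thesis
    using cond_exp_likelihood_ratio[OF assms] AE_space
  proof eventually_elim
    case (elim x)
    then show ?case using f by (auto simp: restr_density_def sp)
  qed
qed

text \<open>
  Bayes' formula expresses the left-hand side by \<open>E (W * a | G)\<close>. As \<open>W\<close> is \<open>H\<close>-measurable, \<open>a\<close> may be
  replaced by \<open>E (a | H)\<close>, and \<open>h * E (a | H) = E (b | H)\<close> makes the result symmetric in \<open>a\<close> and \<open>b\<close>.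
  The same identity at level \<open>G\<close> makes the denominator symmetric. The values of \<open>W\<close> are prescribed
  on the space only, because \<open>f\<close> and \<open>h\<close> are known to be positive only there.
\<close>
lemma cond_exp_sqrt_ratio:
  assumes G: "subalgebra R G" and H: "subalgebra R H" and GH: "subalgebra H G"
    and f: "restr_density P P' G f" and h: "restr_density P P' H h"
    and W_eq: "\<And>x. x \<in> space R \<Longrightarrow> W x = sqrt (h x / f x)"
  shows "AE x in R. real_cond_exp P G W x =
    real_cond_exp R G (\<lambda>x. sqrt (real_cond_exp R H a x * real_cond_exp R H b x)) x
      / sqrt (real_cond_exp R G a x * real_cond_exp R G b x)"
proof -
  interpret G: finite_measure_subalgebra R G by (rule finite_measure_subalgebra_R) fact
  interpret H: finite_measure_subalgebra R H by (rule finite_measure_subalgebra_R) fact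
  have sp: "space G = space R" "space H = space R" using G H by (simp_all add: subalgebra_def)
  have f_meas [measurable]: "f \<in> borel_measurable G" using f by (simp add: restr_density_def)
  have h_meas [measurable]: "h \<in> borel_measurable H" using h by (simp add: restr_density_def)
  have f_H [measurable]: "f \<in> borel_measurable H" by (rule measurable_from_subalg[OF GH f_meas])
  have [measurable]: "f \<in> borel_measurable R" "h \<in> borel_measurable R"
    using measurable_from_subalg[OF G f_meas] measurable_from_subalg[OF H h_meas] by auto
  have f_pos: "x \<in> space R \<Longrightarrow> 0 < f x" for x using f by (auto simp: restr_density_def sp)
  have h_pos: "x \<in> space R \<Longrightarrow> 0 < h x" for x using h by (auto simp: restr_density_def sp)
  have W_H [measurable]: "W \<in> borel_measurable H"
    by (rule measurable_cong[THEN iffD2, of _ _ "\<lambda>x. sqrt (h x / f x)"]) (auto simp: sp W_eq)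
  have [measurable]: "W \<in> borel_measurable R"
    by (rule measurable_from_subalg[OF H W_H])
  have W_int: "integrable P W"
  proof -
    \<comment> \<open>The square of \<open>W\<close> has integral \<open>P (space P)\<close>: pass
      from \<open>P\<close> to \<open>P'\<close> with density \<open>h\<close>, and back with density \<open>f\<close>.\<close>
    have "(\<integral>\<^sup>+x. ennreal (h x / f x) \<partial>P) = (\<integral>\<^sup>+x. ennreal (h x) * ennreal (1 / f x) \<partial>P)"
      using h_pos f_pos by (intro nn_integral_cong) (auto simp: ennreal_mult[symmetric] less_imp_le)
    also have "\<dots> = (\<integral>\<^sup>+x. ennreal (1 / f x) \<partial>P')"
      using h unfolding restr_density_def by (elim conjE) (rule sym, erule bspec, measurable)
    also have "\<dots> = (\<integral>\<^sup>+x. ennreal (f x) * ennreal (1 / f x) \<partial>P)"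
      using f unfolding restr_density_def by (elim conjE) (erule bspec, measurable)
    also have "\<dots> = (\<integral>\<^sup>+x. 1 \<partial>P)"
      using f_pos by (intro nn_integral_cong) (auto simp: ennreal_mult[symmetric] less_imp_le less_imp_neq[symmetric])
    also have "\<dots> < \<infinity>"
      using finite_measure.emeasure_finite[OF finite_measure_P(1), of "space R"] by (simp add: less_top)
    finally have "integrable P (\<lambda>x. h x / f x)"
      using h_pos f_pos by (intro integrableI_nonneg) (auto simp: less_imp_le intro!: AE_I2)
    then have "integrable P (\<lambda>x. sqrt (h x / f x * 1))"
      using finite_measure.integrable_const[OF finite_measure_P(1), of "1::real"] h_pos f_pos
      by (intro integrable_sqrt_mult) (auto simp: less_imp_le intro!: AE_I2)
    then show ?thesis
      by (subst Bochner_Integration.integrable_cong[OF refl, where g = "\<lambda>x. sqrt (h x / f x)"])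
         (auto simp: W_eq)
  qed
  let ?aG = "real_cond_exp R G a" and ?bG = "real_cond_exp R G b"
  let ?aH = "real_cond_exp R H a" and ?bH = "real_cond_exp R H b"
  let ?s = "\<lambda>x. sqrt (?aH x * ?bH x)"
  have Wa_int: "integrable R (\<lambda>x. W x * a x)"
    using W_int by (simp add: integrable_P mult.commute)
  have WaH_int: "integrable R (\<lambda>x. W x * ?aH x)"
    using Wa_int by (intro H.real_cond_exp_intg(1)) auto
  have aH_W: "AE x in R. W x * ?aH x = 1 / sqrt (f x) * ?s x"
    using cond_exp_likelihood_ratio[OF H h] cond_exp_densities_pos[OF H h] AE_space
  proof eventually_elim
    case (elim x)
    then have "?s x = sqrt (h x) * ?aH x"
      by (simp add: real_sqrt_mult)
    then show ?case using elim W_eq[of x] by (simp add: real_sqrt_divide)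
  qed
  have s_int: "integrable R (\<lambda>x. 1 / sqrt (f x) * ?s x)"
    using WaH_int aH_W by (subst integrable_cong_AE[symmetric, where f = "\<lambda>x. W x * ?aH x"]) auto
  have "AE x in R. real_cond_exp R G (\<lambda>x. W x * a x) x = real_cond_exp P G W x * ?aG x"
    using G W_int by (rule Bayes)
  moreover have "AE x in R. real_cond_exp R G (real_cond_exp R H (\<lambda>x. W x * a x)) x
      = real_cond_exp R G (\<lambda>x. W x * a x) x"
    using H GH Wa_int by (rule G.real_cond_exp_nested_subalg)
  moreover have "AE x in R. real_cond_exp R H (\<lambda>x. W x * a x) x = 1 / sqrt (f x) * ?s x"
    using H.real_cond_exp_mult[OF W_H _ Wa_int] aH_W by auto
  then have "AE x in R. real_cond_exp R G (real_cond_exp R H (\<lambda>x. W x * a x)) x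
      = real_cond_exp R G (\<lambda>x. 1 / sqrt (f x) * ?s x) x"
    by (intro G.real_cond_exp_cong) auto
  moreover have "AE x in R. real_cond_exp R G (\<lambda>x. 1 / sqrt (f x) * ?s x) x
      = 1 / sqrt (f x) * real_cond_exp R G ?s x"
    using s_int by (intro G.real_cond_exp_mult) auto
  ultimately show ?thesis
    using cond_exp_likelihood_ratio[OF G f] cond_exp_densities_pos[OF G f] AE_space
  proof eventually_elim
    case (elim x)
    have "real_cond_exp P G W x * ?aG x * sqrt (f x) = real_cond_exp R G ?s x"
      using elim f_pos[of x] by (simp add: field_simps)
    moreover have "sqrt (?aG x * ?bG x) = ?aG x * sqrt (f x)"
      using elim by (simp add: real_sqrt_mult)
    ultimately show ?case
      using elim f_pos[of x] by (simp add: field_simps)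
  qed
qed

lemma mutually_absolutely_continuous_iff:
  "mutually_absolutely_continuous P P' \<longleftrightarrow> (AE x in R. 0 < a x \<and> 0 < b x)"
proof
  assume pos: "AE x in R. 0 < a x \<and> 0 < b x"
  have same_null_sets: "null_sets (density R (\<lambda>x. ennreal (c x))) = null_sets R"
    if c: "c \<in> borel_measurable R" "AE x in R. 0 < c x" for c :: "'a \<Rightarrow> real"
  proof (intro set_eqI)
    fix N
    have "(AE x in R. x \<in> N \<longrightarrow> ennreal (c x) = 0) \<longleftrightarrow> (AE x in R. x \<notin> N)"
    proof
      assume "AE x in R. x \<in> N \<longrightarrow> ennreal (c x) = 0"
      with c(2) show "AE x in R. x \<notin> N" by eventually_elim auto
    next
      assume "AE x in R. x \<notin> N"
      then show "AE x in R. x \<in> N \<longrightarrow> ennreal (c x) = 0" by eventually_elim auto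
    qed
    moreover have "N \<in> null_sets (density R (\<lambda>x. ennreal (c x)))
        \<longleftrightarrow> N \<in> sets R \<and> (AE x in R. x \<in> N \<longrightarrow> ennreal (c x) = 0)"
      using c(1) by (intro null_sets_density_iff) measurable
    moreover have "N \<in> null_sets R \<longleftrightarrow> N \<in> sets R \<and> (AE x in R. x \<notin> N)"
      using AE_iff_null_sets null_setsD2 by blast
    ultimately show "N \<in> null_sets (density R (\<lambda>x. ennreal (c x))) \<longleftrightarrow> N \<in> null_sets R"
      by simp
  qed
  have "AE x in R. 0 < a x" "AE x in R. 0 < b x"
    using pos by auto
  then have "null_sets P = null_sets R" "null_sets P' = null_sets R"
    unfolding P_eq P'_eq by (simp_all add: same_null_sets)
  then show "mutually_absolutely_continuous P P'"
    by (simp add: mutually_absolutely_continuous_def absolutely_continuous_def)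
next
  assume mac: "mutually_absolutely_continuous P P'"
  let ?A = "{x\<in>space R. \<not> 0 < a x}" and ?B = "{x\<in>space R. \<not> 0 < b x}"
  have null_P: "N \<in> null_sets P \<longleftrightarrow> N \<in> sets R \<and> (AE x in R. x \<in> N \<longrightarrow> ennreal (a x) = 0)" for N
    unfolding P_eq by (rule null_sets_density_iff) measurable
  have null_P': "N \<in> null_sets P' \<longleftrightarrow> N \<in> sets R \<and> (AE x in R. x \<in> N \<longrightarrow> ennreal (b x) = 0)" for N
    unfolding P'_eq by (rule null_sets_density_iff) measurable
  have "?A \<in> null_sets P"
    unfolding null_P by (auto intro!: AE_I2 ennreal_neg simp: not_less)
  then have "?A \<in> null_sets P'"
    using mac by (auto simp: mutually_absolutely_continuous_def absolutely_continuous_def)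
  moreover have "?B \<in> null_sets P'"
    unfolding null_P' by (auto intro!: AE_I2 ennreal_neg simp: not_less)
  then have "?B \<in> null_sets P"
    using mac by (auto simp: mutually_absolutely_continuous_def absolutely_continuous_def)
  ultimately have "AE x in R. x \<in> ?A \<longrightarrow> ennreal (b x) = 0" "AE x in R. x \<in> ?B \<longrightarrow> ennreal (a x) = 0"
    unfolding null_P null_P' by blast+
  then show "AE x in R. 0 < a x \<and> 0 < b x"
    using one_pos AE_space by eventually_elim auto
qed

end

section \<open>Equivalence of the two measures\<close>

lemma prod_sqrt_density_ratio:
  assumes "m \<le> k" "\<And>i. m \<le> i \<Longrightarrow> 0 < \<Phi> i x"
  shows "(\<Prod>i=m..k. sqrt (density_ratio \<Phi> i x)) = sqrt (\<Phi> (Suc k) x / \<Phi> m x)"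
  using assms(1)
proof (induction k rule: dec_induct)
  case base
  show ?case by (simp add: density_ratio_def)
next
  case (step k)
  then have "(\<Prod>i=m..Suc k. sqrt (density_ratio \<Phi> i x))
      = sqrt (\<Phi> (Suc k) x / \<Phi> m x) * sqrt (\<Phi> (Suc (Suc k)) x / \<Phi> (Suc k) x)"
    by (simp add: density_ratio_def)
  also have "\<dots> = sqrt (\<Phi> (Suc (Suc k)) x / \<Phi> m x)"
    using assms(2)[of "Suc k"] step.hyps by (simp add: real_sqrt_mult[symmetric])
  finally show ?case .
qed

theorem theorem5p1:
  fixes A P P' :: "'a measure"
    and F :: "nat \<Rightarrow> 'a measure"
    and \<Phi> :: "nat \<Rightarrow> 'a \<Rightarrow> real"
  assumes "\<And>n. 1 \<le> n \<Longrightarrow> subalgebra A (F n)"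
    and "\<And>m n. 1 \<le> m \<Longrightarrow> m \<le> n \<Longrightarrow> sets (F m) \<subseteq> sets (F n)"
    and "sets (F 1) = {{}, space A}"
    and "sets A = sigma_sets (space A) (\<Union>n\<in>{1..}. sets (F n))"
    and "prob_space P" and "sets P = sets A"
    and "prob_space P'" and "sets P' = sets A"
    and "\<And>n. 1 \<le> n \<Longrightarrow>
      mutually_absolutely_continuous (restr_to_subalg P (F n)) (restr_to_subalg P' (F n))"
    and "\<And>n. 1 \<le> n \<Longrightarrow> positive_restr_RN_version P P' (F n) (\<Phi> n)"
  shows
    "(AE x in sum_measure P P'.
        (\<forall>n\<ge>1. convergent (\<lambda>k. cond_sqrt_prod P F \<Phi> n k x)) \<and>
        convergent (\<lambda>n. lim (\<lambda>k. cond_sqrt_prod P F \<Phi> n k x))) \<and>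
     (mutually_absolutely_continuous P P' \<longleftrightarrow>
        (AE x in sum_measure P P'. lim (\<lambda>n. lim (\<lambda>k. cond_sqrt_prod P F \<Phi> n k x)) = 1)) \<and>
     (mutually_absolutely_continuous P P' \<longrightarrow>
        tendsto_in_L2 P (\<lambda>n x. sqrt (\<Phi> n x)) (\<lambda>x. sqrt (enn2real (RN_deriv P P' x))))"
proof -
  interpret P: prob_space P by fact
  interpret P': prob_space P' by fact
  have sets_P': "sets P' = sets P" using assms(6,8) by simp
  have space_P: "space P = space A" using assms(6) by (rule sets_eq_imp_space_eq)
  have space_F: "space (F n) = space P" if "1 \<le> n" for n
    using assms(1)[OF that] by (simp add: subalgebra_def space_P)
  have sub_P: "subalgebra P (F n)" if "1 \<le> n" for n
    using assms(1)[OF that] by (simp add: subalgebra_def assms(6) space_P)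
  have dens: "restr_density P P' (F n) (\<Phi> n)" if "1 \<le> n" for n
    using assms(10)[OF that] nn_integral_positive_restr_RN_version[OF P.finite_measure_axioms sets_P'
        sub_P[OF that] assms(9)[OF that] assms(10)[OF that]]
    by (simp add: restr_density_def positive_restr_RN_version_def)
  have \<Phi>_pos: "0 < \<Phi> n x" if "1 \<le> n" "x \<in> space P" for n x
    using dens[OF that(1)] that(2) by (simp add: restr_density_def space_F[OF that(1)])
  have generates: "sets P = sigma_sets (space P) (\<Union>n. sets (F (Suc n)))"
  proof -
    have "{1..} = range Suc"
      by (auto simp: image_iff Suc_le_eq intro: not0_implies_Suc dest: gr0_implies_Suc)
    then show ?thesis using assms(4,6) by (simp add: space_P)
  qed

  define R where "R = sum_measure P P'"
  have sets_R: "sets R = sets P" and space_R: "space R = space P"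
    by (simp_all add: R_def)
  obtain a where a: "a \<in> borel_measurable R" "\<And>x. 0 \<le> a x" "\<And>x. a x \<le> 1"
    and P_R: "P = density R (\<lambda>x. ennreal (a x))" and P'_R: "P' = density R (\<lambda>x. ennreal (1 - a x))"
    using sum_measure_densities[OF P.finite_measure_axioms P'.finite_measure_axioms sets_P']
    unfolding R_def by metis
  define b where "b x = 1 - a x" for x
  interpret R: finite_measure R
    unfolding R_def by (intro finite_measure_sum_measure P.finite_measure_axioms P'.finite_measure_axioms sets_P')
  have a_int: "integrable R a" using a by (intro R.integrable_const_bound[of _ 1]) auto
  have b_int: "integrable R b" unfolding b_def using a_int by auto
  have b: "0 \<le> b x" "b x \<le> 1" for x using a(2,3)[of x] by (auto simp: b_def)
  have sub_R: "subalgebra R (F n)" if "1 \<le> n" for n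
    using sub_P[OF that] by (simp add: subalgebra_def sets_R space_R)
  \<comment> \<open>The locale indexes its filtration from \<open>0\<close>, so \<open>E.cond_exp n\<close> conditions on \<open>F (n + 1)\<close>.\<close>
  interpret E: exhausting_filtration R "\<lambda>n. F (Suc n)"
  proof
    show "sets R = sigma_sets (space R) (\<Union>n. sets (F (Suc n)))"
      using generates by (simp add: sets_R space_R)
  qed (simp_all add: sub_R assms(2))
  interpret pair: dominated_pair R a b P P'
  proof
    show "AE x in R. 0 < a x \<or> 0 < b x"
      by (rule AE_I2) (simp add: b_def, linarith)
    show "P' = density R (\<lambda>x. ennreal (b x))" unfolding b_def by (rule P'_R)
    show "integrable R a" by (rule a_int)
    show "integrable R b" by (rule b_int)
    show "0 \<le> a x" for x by (rule a(2))
    show "0 \<le> b x" for x by (rule b(1))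
    show "P = density R (\<lambda>x. ennreal (a x))" by (rule P_R)
  qed

  let ?s = "\<lambda>x. sqrt (a x * b x)"
  let ?L = "\<lambda>n x. E.cond_exp n ?s x / sqrt (E.cond_exp n a x * E.cond_exp n b x)"
  let ?X = "\<lambda>n k x. cond_sqrt_prod P F \<Phi> n k x"

  \<comment> \<open>The last factor of the product involves \<open>\<Phi> (k + 1)\<close>, hence \<open>F (k + 1)\<close>, which is level \<open>k\<close> of \<open>E\<close>.\<close>
  have X_eq: "AE x in R. ?X (Suc n) k x = E.cond_exp n (\<lambda>x. sqrt (E.cond_exp k a x * E.cond_exp k b x)) x
      / sqrt (E.cond_exp n a x * E.cond_exp n b x)" if "Suc n \<le> k" for n k
    unfolding cond_sqrt_prod_def
  proof (rule pair.cond_exp_sqrt_ratio)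
    show "subalgebra (F (Suc k)) (F (Suc n))"
      using that by (intro E.subalgebra_le) simp
    show "(\<Prod>i=Suc n..k. sqrt (density_ratio \<Phi> i x)) = sqrt (\<Phi> (Suc k) x / \<Phi> (Suc n) x)"
      if "x \<in> space R" for x
      using \<open>Suc n \<le> k\<close> that \<Phi>_pos by (intro prod_sqrt_density_ratio) auto
  qed (auto intro: sub_R dens)

  have ce_bounds: "AE x in R. 0 \<le> E.cond_exp k c x \<and> E.cond_exp k c x \<le> 1"
    if "integrable R c" "\<And>x. 0 \<le> c x" "\<And>x. c x \<le> 1" for c k
    using E.level.real_cond_exp_ge_c[OF that(1), of 0 k] E.level.real_cond_exp_le_c[OF that(1), of 1 k] that
    by auto
  have inner: "AE x in R. (\<lambda>k. E.cond_exp n (\<lambda>x. sqrt (E.cond_exp k a x * E.cond_exp k b x)) x)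
      \<longlonglongrightarrow> E.cond_exp n ?s x" for n
  proof (rule E.level.real_cond_exp_dominated_convergence[where w = "\<lambda>x. 1"])
    show "AE x in R. (\<lambda>k. sqrt (E.cond_exp k a x * E.cond_exp k b x)) \<longlonglongrightarrow> ?s x"
      using E.cond_exp_tendsto_AE[OF a_int] E.cond_exp_tendsto_AE[OF b_int]
      by eventually_elim (intro tendsto_intros)
    show "AE x in R. \<bar>sqrt (E.cond_exp k a x * E.cond_exp k b x)\<bar> \<le> 1" for k
      using ce_bounds[OF a_int a(2,3), of k] ce_bounds[OF b_int b, of k]
      by eventually_elim (auto simp: mult_le_one)
  qed (use a b_int in auto)

  have outer: "AE x in R. (\<lambda>n. ?L n x) \<longlonglongrightarrow> (if 0 < a x \<and> 0 < b x then 1 else 0)"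
    using pair.cond_exp_densities_pos[OF sub_R dens] a b a_int b_int pair.one_pos
    by (intro E.hellinger_quotient_tendsto) auto

  have "AE x in R. \<forall>n k. Suc n \<le> k \<longrightarrow> ?X (Suc n) k x
      = E.cond_exp n (\<lambda>x. sqrt (E.cond_exp k a x * E.cond_exp k b x)) x
        / sqrt (E.cond_exp n a x * E.cond_exp n b x)"
    unfolding AE_all_countable using X_eq by auto
  moreover have "AE x in R. \<forall>n. 0 < E.cond_exp n a x \<and> 0 < E.cond_exp n b x"
    unfolding AE_all_countable using pair.cond_exp_densities_pos[OF sub_R dens] by auto
  moreover have "AE x in R. \<forall>n. (\<lambda>k. E.cond_exp n (\<lambda>x. sqrt (E.cond_exp k a x * E.cond_exp k b x)) x)
      \<longlonglongrightarrow> E.cond_exp n ?s x"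
    unfolding AE_all_countable using inner by auto
  ultimately have limits: "AE x in R. (\<forall>n\<ge>1. convergent (\<lambda>k. ?X n k x)) \<and>
      (\<lambda>n. lim (\<lambda>k. ?X n k x)) \<longlonglongrightarrow> (if 0 < a x \<and> 0 < b x then 1 else 0)"
    using outer
  proof eventually_elim
    case (elim x)
    have X_lim: "(\<lambda>k. ?X (Suc n) k x) \<longlonglongrightarrow> ?L n x" for n
    proof (rule Lim_transform_eventually)
      show "(\<lambda>k. E.cond_exp n (\<lambda>x. sqrt (E.cond_exp k a x * E.cond_exp k b x)) x
          / sqrt (E.cond_exp n a x * E.cond_exp n b x)) \<longlonglongrightarrow> ?L n x"
        using elim(2,3) by (intro tendsto_divide tendsto_const) (auto simp: less_imp_neq[symmetric])
      show "\<forall>\<^sub>F k in sequentially. E.cond_exp n (\<lambda>x. sqrt (E.cond_exp k a x * E.cond_exp k b x)) x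
          / sqrt (E.cond_exp n a x * E.cond_exp n b x) = ?X (Suc n) k x"
        by (rule eventually_sequentiallyI[of "Suc n"]) (use elim(1) in auto)
    qed
    have "convergent (\<lambda>k. ?X n k x)" if "1 \<le> n" for n
      using X_lim[of "n - 1"] that by (auto simp: convergent_def)
    moreover have "(\<lambda>n. lim (\<lambda>k. ?X (Suc n) k x)) \<longlonglongrightarrow> (if 0 < a x \<and> 0 < b x then 1 else 0)"
      using elim(4) by (simp only: limI[OF X_lim])
    ultimately show ?case
      by (blast intro: LIMSEQ_imp_Suc)
  qed

  have "AE x in R. (\<forall>n\<ge>1. convergent (\<lambda>k. ?X n k x)) \<and> convergent (\<lambda>n. lim (\<lambda>k. ?X n k x))"
    using limits by eventually_elim (auto simp: convergent_def)
  moreover have "mutually_absolutely_continuous P P' \<longleftrightarrow> (AE x in R. lim (\<lambda>n. lim (\<lambda>k. ?X n k x)) = 1)"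
  proof -
    have "AE x in R. (0 < a x \<and> 0 < b x) \<longleftrightarrow> lim (\<lambda>n. lim (\<lambda>k. ?X n k x)) = 1"
      using limits
    proof eventually_elim
      case (elim x)
      from limI[OF conjunct2[OF elim]] show ?case by simp
    qed
    then show ?thesis
      unfolding pair.mutually_absolutely_continuous_iff by (auto elim: eventually_elim2)
  qed
  moreover have "tendsto_in_L2 P (\<lambda>n x. sqrt (\<Phi> n x)) (\<lambda>x. sqrt (enn2real (RN_deriv P P' x)))"
    if mac: "mutually_absolutely_continuous P P'"
  proof -
    have ac: "absolutely_continuous P P'" using mac by (simp add: mutually_absolutely_continuous_def)
    define g where "g x = enn2real (RN_deriv P P' x)" for x
    have g_meas [measurable]: "g \<in> borel_measurable P" unfolding g_def by measurable
    have g_nonneg: "0 \<le> g x" for x by (simp add: g_def)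
    have "AE x in P. RN_deriv P P' x \<noteq> \<infinity>"
      by (rule P.RN_deriv_finite[OF P'.sigma_finite_measure_axioms ac sets_P'])
    then have P'_g: "P' = density P (\<lambda>x. ennreal (g x))"
      by (subst P.density_RN_deriv[OF ac sets_P', symmetric], intro density_cong)
         (auto simp: g_def less_top elim!: eventually_mono)
    have g_int: "integrable P g"
    proof (rule integrableI_nonneg)
      have "emeasure P' (space P) = (\<integral>\<^sup>+x\<in>space P. ennreal (g x) \<partial>P)"
        by (subst P'_g) (rule emeasure_density, measurable)
      also have "\<dots> = (\<integral>\<^sup>+x. ennreal (g x) \<partial>P)"
        by (intro nn_integral_cong) auto
      finally show "(\<integral>\<^sup>+x. ennreal (g x) \<partial>P) < \<infinity>"
        using P'.emeasure_finite[of "space P"] by (simp add: less_top)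
    qed (auto simp: g_nonneg)
    \<comment> \<open>Relative to \<open>P\<close> itself, the likelihood ratio identity says that \<open>\<Phi> n\<close> is the conditional expectation of \<open>g\<close>.\<close>
    interpret relative: dominated_pair P "\<lambda>x. 1" g P P'
      by standard (use g_int g_nonneg P'_g in \<open>auto simp: density_1\<close>)
    interpret EP: exhausting_filtration P "\<lambda>n. F (Suc n)"
    proof
      show "sets P = sigma_sets (space P) (\<Union>n. sets (F (Suc n)))"
        by (rule generates)
    qed (simp_all add: sub_P assms(2))
    have \<Phi>_meas: "\<Phi> n \<in> borel_measurable P" if "1 \<le> n" for n
      using dens[OF that] sub_P[OF that] by (auto simp: restr_density_def intro: measurable_from_subalg)
    have \<Phi>_eq: "AE x in P. EP.cond_exp n g x = \<Phi> (Suc n) x" for n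
    proof -
      have "AE x in P. EP.cond_exp n (\<lambda>x. 1) x = 1"
        by (intro EP.level.real_cond_exp_F_meas) auto
      moreover have "AE x in P. EP.cond_exp n g x = \<Phi> (Suc n) x * EP.cond_exp n (\<lambda>x. 1) x"
        by (intro relative.cond_exp_likelihood_ratio sub_P dens) simp_all
      ultimately show ?thesis
        by eventually_elim simp
    qed
    have "square_integrable P (\<lambda>x. sqrt (\<Phi> n x))" if "1 \<le> n" for n
    proof -
      have "integrable P (\<Phi> n)"
        using sub_P[OF that] dens[OF that] by (rule relative.integrable_restr_density)
      moreover have "integrable P (\<lambda>x. (sqrt (\<Phi> n x))\<^sup>2) \<longleftrightarrow> integrable P (\<Phi> n)"
        using \<Phi>_pos[OF that] by (intro Bochner_Integration.integrable_cong refl) (simp add: less_imp_le)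
      ultimately show ?thesis
        using \<Phi>_meas[OF that] by (simp add: square_integrable_def)
    qed
    moreover have "square_integrable P (\<lambda>x. sqrt (g x))"
      using g_int by (simp add: square_integrable_def g_nonneg)
    moreover have "(\<lambda>n. sqrt (\<integral>x. (sqrt (\<Phi> n x) - sqrt (g x))\<^sup>2 \<partial>P)) \<longlonglongrightarrow> 0"
    proof (rule LIMSEQ_imp_Suc)
      have "(\<integral>x. (sqrt (\<Phi> (Suc n) x) - sqrt (g x))\<^sup>2 \<partial>P)
          = (\<integral>x. (sqrt (EP.cond_exp n g x) - sqrt (g x))\<^sup>2 \<partial>P)" for n
        using \<Phi>_meas[of "Suc n"] \<Phi>_eq[of n] by (intro integral_cong_AE) auto
      then show "(\<lambda>n. sqrt (\<integral>x. (sqrt (\<Phi> (Suc n) x) - sqrt (g x))\<^sup>2 \<partial>P)) \<longlonglongrightarrow> 0"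
        using EP.sqrt_cond_exp_tendsto_L2[OF g_int g_nonneg] by simp
    qed
    ultimately show ?thesis
      unfolding tendsto_in_L2_def g_def by blast
  qed
  ultimately show ?thesis
    unfolding R_def by blast
qed

end
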